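(* Let $X$ be a nonempty set and $\theta\in\mathscr{T}_X$. The duality $\chi_{\Gamma_\theta}:\Gamma_\theta(-,-)\to\Delta_\theta(-,-)$ is given by $$\chi_{\Gamma_\theta}(A,\bar\pi):\theta a\mapsto a\theta .$$
   Context: Functions are written on the right and composed from left to right. $\mathscr{T}_X$ is the semigroup of all maps $X\to X$. The variant $\mathscr{T}_X^\theta$ is the set $\mathscr{T}_X$ with the operation $a\ast b=a\theta b$, and $Reg(\mathscr{T}_X^\theta)$ is the subsemigroup of its regular elements. For $a\in\mathscr{T}_X$, $\mathrm{Im}\,a$ is its image and $\pi_a$ is the partition of $X$ into the nonempty fibres of $a$. A subset $A\subseteq X$ saturates a partition $\pi$ of $X$ if each $\pi$-class contains at least one element of $A$; $\pi$ separates $A$ if each $\pi$-class contains at most one element of $A$; $A$ is a cross-section of $\pi$ if each $\pi$-class contains exactly one element of $A$. $v\mathcal{C}$ denotes the set of objects of a category $\mathcal{C}$. $\mathscr{P}_\theta$ is the category whose objects are the nonempty subsets $A\subseteq X$ separated by $\pi_\theta$ and whose morphisms $A\to B$ are all maps. For such $A$, $\theta_{|A}:A\to A\theta$ is a bijection with inverse $(\theta_{|A})^{-1}$. For a partition $\pi$ of $X$, $\bar\pi$ is the set of all maps from $\pi$ to $X$, regarded as maps $X\to X$ constant on $\pi$-classes; $\bar\pi_a$ means $\overline{\pi_a}$. $\Pi_\theta$ is the category with objects $\{\bar\pi:\mathrm{Im}\,\theta\text{ saturates }\pi\}$, a morphism $\eta^*:\bar\pi_1\to\bar\pi_2$ being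 given by a map $\eta:\pi_2\to\pi_1$ via $\alpha\mapsto\eta\alpha$. For $\bar\pi\in v\Pi_\theta$, $\theta^*(\bar\pi)=\overline{(\pi)\theta^{-1}}$, where $(\pi)\theta^{-1}$ is the partition of $X$ whose classes are the inverse images under $\theta$ of the $\pi$-classes. The bifunctors $\Gamma_\theta(-,-),\Delta_\theta(-,-):\mathscr{P}_\theta\times\Pi_\theta\to\mathbf{Set}$ are defined, for all $(A,\bar\pi)\in v\mathscr{P}_\theta\times v\Pi_\theta$ and $(f,\eta^* ):(A,\bar\pi_1)\to(B,\bar\pi_2)$, by $$\Gamma_\theta(A,\bar\pi)=\{a\in\mathscr{T}_X:\mathrm{Im}\,a\subseteq A\text{ and }\bar\pi_a\subseteq\theta^*(\bar\pi)\},\qquad \Gamma_\theta(f,\eta^* ):a\mapsto\theta\,\eta\,(\theta_{|C})^{-1}a f,$$ $$\Delta_\theta(A,\bar\pi)=\{a\in\mathscr{T}_X:\mathrm{Im}\,a\subseteq \theta(A)\text{ and }\bar\pi_a\subseteq\bar\pi\},\qquad \Delta_\theta(f,\eta^* ):a\mapsto\eta\, a\,(\theta_{|A})^{-1}f\,\theta ,$$ where $\theta(A)=A\theta$ is the image of $A$ under $\theta$, $C\in v\mathscr{P}_\theta$ is a cross-section of $(\pi_1)\theta^{-1}$, and $\eta:\pi_2\to\pi_1$ is restricted in these formulas to give a mapping between cross-sections of the partitions. The union of the sets $\Gamma_\theta(A,\bar\pi)$ is the semigroup $U\Gamma_\theta=\{\theta a:a\in Reg(\mathscr{T}_X^\theta)\}$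 and the union of the sets $\Delta_\theta(A,\bar\pi)$ is the semigroup $U\Delta_\theta=\{a\theta:a\in Reg(\mathscr{T}_X^\theta)\}$; elements of $\Gamma_\theta(A,\bar\pi)$ are written in the form $\theta a$ accordingly. The duality of the semigroup $Reg(\mathscr{T}_X^\theta)$ is the natural isomorphism $\chi_{\Gamma_\theta}$ between the bifunctors $\Gamma_\theta(-,-)$ and $\Delta_\theta(-,-)$, with components $\chi_{\Gamma_\theta}(A,\bar\pi):\Gamma_\theta(A,\bar\pi)\to\Delta_\theta(A,\bar\pi)$.
   Formalization: In θa ↦ aθ, the regular element a is required to satisfy Im a ⊆ A and π̄_a ⊆ π̄, because θa alone does not determine aθ; every element of Γ_θ(A,π̄) is θa for such an a. *)

theory Defs
  imports "HOL-Library.FuncSet" "HOL-Library.Disjoint_Sets"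
begin

text \<open>The nonempty set \<open>X\<close> is the universe of the type \<open>'x\<close>, so its full transformation semigroup is
  the type \<open>'x \<Rightarrow> 'x\<close>.\<close>

text \<open>Functions are written on the right: \<open>a \<Zcomp> b\<close> is first \<open>a\<close>, then \<open>b\<close>.\<close>

definition rcomp :: "('a \<Rightarrow> 'b) \<Rightarrow> ('b \<Rightarrow> 'c) \<Rightarrow> 'a \<Rightarrow> 'c"  (infixl "\<Zcomp>" 75)
  where "a \<Zcomp> b = (\<lambda>x. b (a x))"

definition variant_mult :: "('x \<Rightarrow> 'x) \<Rightarrow> ('x \<Rightarrow> 'x) \<Rightarrow> ('x \<Rightarrow> 'x) \<Rightarrow> ('x \<Rightarrow> 'x)"
  where "variant_mult \<theta> a b = a \<Zcomp> \<theta> \<Zcomp> b"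

definition Reg :: "('x \<Rightarrow> 'x) \<Rightarrow> ('x \<Rightarrow> 'x) set"
  where "Reg \<theta> = {a. \<exists>b. variant_mult \<theta> (variant_mult \<theta> a b) a = a}"

definition fibres :: "('x \<Rightarrow> 'x) \<Rightarrow> 'x set set"
  where "fibres a = (\<lambda>y. a -` {y}) ` range a"

definition saturates :: "'x set \<Rightarrow> 'x set set \<Rightarrow> bool"
  where "saturates A \<pi> \<longleftrightarrow> (\<forall>P\<in>\<pi>. \<exists>x. x \<in> A \<inter> P)"

definition separates :: "'x set set \<Rightarrow> 'x set \<Rightarrow> bool"
  where "separates \<pi> A \<longleftrightarrow> (\<forall>P\<in>\<pi>. \<forall>x\<in>A \<inter> P. \<forall>y\<in>A \<inter> P. x = y)"

definition cross_section :: "'x set \<Rightarrow> 'x set set \<Rightarrow> bool"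
  where "cross_section A \<pi> \<longleftrightarrow> (\<forall>P\<in>\<pi>. \<exists>!x. x \<in> A \<inter> P)"

definition class_of :: "'x set set \<Rightarrow> 'x \<Rightarrow> 'x set"
  where "class_of \<pi> x = (THE P. P \<in> \<pi> \<and> x \<in> P)"

text \<open>The partition \<open>(\<pi>)\<theta>\<^sup>-\<^sup>1\<close>. All its members are nonempty when the image of \<open>\<theta>\<close> saturates \<open>\<pi>\<close>,
  the only case in which it is used.\<close>

definition inv_image_part :: "('x \<Rightarrow> 'x) \<Rightarrow> 'x set set \<Rightarrow> 'x set set"
  where "inv_image_part \<theta> \<pi> = (\<lambda>P. \<theta> -` P) ` \<pi>"

definition bar :: "'x set set \<Rightarrow> ('x \<Rightarrow> 'x) set"
  where "bar \<pi> = {\<alpha>. \<forall>P\<in>\<pi>. \<forall>x\<in>P. \<forall>y\<in>P. \<alpha> x = \<alpha> y}"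

text \<open>A partition is determined by its set of maps (\<open>part_of_bar\<close> below).\<close>

definition part_of :: "('x \<Rightarrow> 'x) set \<Rightarrow> 'x set set"
  where "part_of Q = (THE \<pi>. partition_on UNIV \<pi> \<and> Q = bar \<pi>)"

text \<open>The map \<open>\<eta>\<^sup>* : \<alpha> \<mapsto> \<eta>\<alpha>\<close>, where \<open>\<alpha> \<in> bar \<pi>1\<close> is regarded as a map on \<open>\<pi>1\<close>
  and \<open>\<eta>\<alpha>\<close> as a map on \<open>X\<close> constant on the classes of \<open>\<pi>2\<close>.\<close>

definition star :: "'x set set \<Rightarrow> 'x set set \<Rightarrow> ('x set \<Rightarrow> 'x set) \<Rightarrow> ('x \<Rightarrow> 'x) \<Rightarrow> ('x \<Rightarrow> 'x)"
  where "star \<pi>1 \<pi>2 \<eta> = (\<lambda>\<alpha>\<in>bar \<pi>1. \<lambda>x. the_elem (\<alpha> ` \<eta> (class_of \<pi>2 x)))"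

text \<open>The map \<open>\<eta>\<close> is determined by \<open>\<eta>\<^sup>*\<close> (\<open>unstar_star\<close> below).\<close>

definition unstar :: "'x set set \<Rightarrow> 'x set set \<Rightarrow> (('x \<Rightarrow> 'x) \<Rightarrow> ('x \<Rightarrow> 'x)) \<Rightarrow> 'x set \<Rightarrow> 'x set"
  where "unstar \<pi>1 \<pi>2 h = (THE \<eta>. \<eta> \<in> \<pi>2 \<rightarrow>\<^sub>E \<pi>1 \<and> h = star \<pi>1 \<pi>2 \<eta>)"

text \<open>Morphisms carry no domain or codomain, so composition takes the three objects as arguments;
  \<open>Comp C a b c f g\<close> is first \<open>f : a \<rightarrow> b\<close>, then \<open>g : b \<rightarrow> c\<close>.\<close>

record ('o, 'm) cat =
  Obj :: "'o set"
  Hom :: "'o \<Rightarrow> 'o \<Rightarrow> 'm set"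
  Id :: "'o \<Rightarrow> 'm"
  Comp :: "'o \<Rightarrow> 'o \<Rightarrow> 'o \<Rightarrow> 'm \<Rightarrow> 'm \<Rightarrow> 'm"

definition category :: "('o, 'm) cat \<Rightarrow> bool"
  where "category C \<longleftrightarrow>
    (\<forall>a\<in>Obj C. Id C a \<in> Hom C a a) \<and>
    (\<forall>a\<in>Obj C. \<forall>b\<in>Obj C. \<forall>c\<in>Obj C. \<forall>f\<in>Hom C a b. \<forall>g\<in>Hom C b c.
        Comp C a b c f g \<in> Hom C a c) \<and>
    (\<forall>a\<in>Obj C. \<forall>b\<in>Obj C. \<forall>f\<in>Hom C a b.
        Comp C a a b (Id C a) f = f \<and> Comp C a b b f (Id C b) = f) \<and>
    (\<forall>a\<in>Obj C. \<forall>b\<in>Obj C. \<forall>c\<in>Obj C. \<forall>d\<in>Obj C.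
      \<forall>f\<in>Hom C a b. \<forall>g\<in>Hom C b c. \<forall>h\<in>Hom C c d.
        Comp C a c d (Comp C a b c f g) h = Comp C a b d f (Comp C b c d g h))"

definition prod_cat :: "('o, 'm) cat \<Rightarrow> ('p, 'n) cat \<Rightarrow> ('o \<times> 'p, 'm \<times> 'n) cat"
  where "prod_cat C D =
    \<lparr> Obj = Obj C \<times> Obj D,
      Hom = (\<lambda>(a, p) (b, q). Hom C a b \<times> Hom D p q),
      Id = (\<lambda>(a, p). (Id C a, Id D p)),
      Comp = (\<lambda>(a, p) (b, q) (c, r) (f, h) (g, k). (Comp C a b c f g, Comp D p q r h k)) \<rparr>"

text \<open>Maps between the values of a functor to \<open>Set\<close> are represented by HOL functions, of which only
  the restriction to the source set matters.\<close>

record ('o, 'm, 's) setfun =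
  on_obj :: "'o \<Rightarrow> 's set"
  on_mor :: "'o \<Rightarrow> 'o \<Rightarrow> 'm \<Rightarrow> 's \<Rightarrow> 's"

definition set_functor :: "('o, 'm) cat \<Rightarrow> ('o, 'm, 's) setfun \<Rightarrow> bool"
  where "set_functor C F \<longleftrightarrow>
    (\<forall>a\<in>Obj C. \<forall>b\<in>Obj C. \<forall>f\<in>Hom C a b. on_mor F a b f \<in> on_obj F a \<rightarrow> on_obj F b) \<and>
    (\<forall>a\<in>Obj C. \<forall>s\<in>on_obj F a. on_mor F a a (Id C a) s = s) \<and>
    (\<forall>a\<in>Obj C. \<forall>b\<in>Obj C. \<forall>c\<in>Obj C. \<forall>f\<in>Hom C a b. \<forall>g\<in>Hom C b c. \<forall>s\<in>on_obj F a.
        on_mor F a c (Comp C a b c f g) s = on_mor F b c g (on_mor F a b f s))"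

definition natural_iso ::
  "('o, 'm) cat \<Rightarrow> ('o, 'm, 's) setfun \<Rightarrow> ('o, 'm, 's) setfun \<Rightarrow> ('o \<Rightarrow> 's \<Rightarrow> 's) \<Rightarrow> bool"
  where "natural_iso C F G \<chi> \<longleftrightarrow>
    category C \<and> set_functor C F \<and> set_functor C G \<and>
    (\<forall>a\<in>Obj C. bij_betw (\<chi> a) (on_obj F a) (on_obj G a)) \<and>
    (\<forall>a\<in>Obj C. \<forall>b\<in>Obj C. \<forall>f\<in>Hom C a b. \<forall>s\<in>on_obj F a.
        \<chi> b (on_mor F a b f s) = on_mor G a b f (\<chi> a s))"

definition P_cat :: "('x \<Rightarrow> 'x) \<Rightarrow> ('x set, 'x \<Rightarrow> 'x) cat"
  where "P_cat \<theta> =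
    \<lparr> Obj = {A. A \<noteq> {} \<and> separates (fibres \<theta>) A},
      Hom = (\<lambda>A B. A \<rightarrow>\<^sub>E B),
      Id = (\<lambda>A. \<lambda>x\<in>A. x),
      Comp = (\<lambda>A B C f g. compose A g f) \<rparr>"

definition Pi_cat :: "('x \<Rightarrow> 'x) \<Rightarrow> (('x \<Rightarrow> 'x) set, ('x \<Rightarrow> 'x) \<Rightarrow> ('x \<Rightarrow> 'x)) cat"
  where "Pi_cat \<theta> =
    \<lparr> Obj = {bar \<pi> |\<pi>. partition_on UNIV \<pi> \<and> saturates (range \<theta>) \<pi>},
      Hom = (\<lambda>Q1 Q2. star (part_of Q1) (part_of Q2) ` (part_of Q2 \<rightarrow>\<^sub>E part_of Q1)),
      Id = (\<lambda>Q. \<lambda>\<alpha>\<in>Q. \<alpha>),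
      Comp = (\<lambda>Q1 Q2 Q3 h k. compose Q1 k h) \<rparr>"

definition theta_star :: "('x \<Rightarrow> 'x) \<Rightarrow> ('x \<Rightarrow> 'x) set \<Rightarrow> ('x \<Rightarrow> 'x) set"
  where "theta_star \<theta> Q = bar (inv_image_part \<theta> (part_of Q))"

text \<open>The map \<open>\<eta> : \<pi>2 \<rightarrow> \<pi>1\<close> restricted to a map into a cross-section \<open>D\<close> of \<open>\<pi>1\<close>. It is taken
  on all of \<open>X\<close>, each point standing for its \<open>\<pi>2\<close>-class, so that no cross-section of \<open>\<pi>2\<close>
  has to be chosen.\<close>

definition cs_map :: "'x set set \<Rightarrow> ('x set \<Rightarrow> 'x set) \<Rightarrow> 'x set \<Rightarrow> 'x \<Rightarrow> 'x"
  where "cs_map \<pi>2 \<eta> D x = (THE d. d \<in> D \<inter> \<eta> (class_of \<pi>2 x))"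

text \<open>The cross-section \<open>C\<close> of \<open>(\<pi>1)\<theta>\<^sup>-\<^sup>1\<close>; \<open>\<theta> ` C\<close> is then a cross-section of \<open>\<pi>1\<close>. The bifunctors
  do not depend on the choice (\<open>Gamma_mor_indep\<close> and \<open>Delta_mor_indep\<close> below).\<close>

definition chosen_cs :: "('x \<Rightarrow> 'x) \<Rightarrow> 'x set set \<Rightarrow> 'x set"
  where "chosen_cs \<theta> \<pi> =
    (SOME C. C \<in> Obj (P_cat \<theta>) \<and> cross_section C (inv_image_part \<theta> \<pi>))"

definition Gamma :: "('x \<Rightarrow> 'x) \<Rightarrow>
    ('x set \<times> ('x \<Rightarrow> 'x) set, ('x \<Rightarrow> 'x) \<times> (('x \<Rightarrow> 'x) \<Rightarrow> ('x \<Rightarrow> 'x)), 'x \<Rightarrow> 'x) setfun"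
  where "Gamma \<theta> =
    \<lparr> on_obj = (\<lambda>(A, Q). {a. range a \<subseteq> A \<and> bar (fibres a) \<subseteq> theta_star \<theta> Q}),
      on_mor = (\<lambda>(A, Q1) (B, Q2) (f, h) a.
        let \<eta> = unstar (part_of Q1) (part_of Q2) h; C = chosen_cs \<theta> (part_of Q1)
        in \<theta> \<Zcomp> cs_map (part_of Q2) \<eta> (\<theta> ` C) \<Zcomp> inv_into C \<theta> \<Zcomp> a \<Zcomp> f) \<rparr>"

definition Delta :: "('x \<Rightarrow> 'x) \<Rightarrow>
    ('x set \<times> ('x \<Rightarrow> 'x) set, ('x \<Rightarrow> 'x) \<times> (('x \<Rightarrow> 'x) \<Rightarrow> ('x \<Rightarrow> 'x)), 'x \<Rightarrow> 'x) setfun"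
  where "Delta \<theta> =
    \<lparr> on_obj = (\<lambda>(A, Q). {a. range a \<subseteq> \<theta> ` A \<and> bar (fibres a) \<subseteq> Q}),
      on_mor = (\<lambda>(A, Q1) (B, Q2) (f, h) a.
        let \<eta> = unstar (part_of Q1) (part_of Q2) h; C = chosen_cs \<theta> (part_of Q1)
        in cs_map (part_of Q2) \<eta> (\<theta> ` C) \<Zcomp> a \<Zcomp> inv_into A \<theta> \<Zcomp> f \<Zcomp> \<theta>) \<rparr>"

text \<open>The natural isomorphism between the two bifunctors is unique, up to values of its components
  outside their domains: naturality with respect to maps out of singletons and to the partition with
  one class determines it. So this property may be read as ``\<open>\<chi>\<close> is the duality''.\<close>

definition duality :: "('x \<Rightarrow> 'x) \<Rightarrow> ('x set \<times> ('x \<Rightarrow> 'x) set \<Rightarrow> ('x \<Rightarrow> 'x) \<Rightarrow> ('x \<Rightarrow> 'x)) \<Rightarrow> bool"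
  where "duality \<theta> \<chi> \<longleftrightarrow>
    natural_iso (prod_cat (P_cat \<theta>) (Pi_cat \<theta>)) (Gamma \<theta>) (Delta \<theta>) \<chi>"

text \<open>The regular elements \<open>a\<close> used to write the elements of \<open>\<Gamma>\<^sub>\<theta>(A, Q)\<close> as \<open>\<theta>a\<close>. Membership of \<open>\<theta>a\<close>
  in \<open>\<Gamma>\<^sub>\<theta>(A, Q)\<close> alone does not determine \<open>a\<close>, nor \<open>a\<theta>\<close>; requiring \<open>a\<close> to be constant on the
  classes of the partition named by \<open>Q\<close> does.\<close>

definition Reg_at :: "('x \<Rightarrow> 'x) \<Rightarrow> 'x set \<Rightarrow> ('x \<Rightarrow> 'x) set \<Rightarrow> ('x \<Rightarrow> 'x) set"
  where "Reg_at \<theta> A Q = {a \<in> Reg \<theta>. range a \<subseteq> A \<and> bar (fibres a) \<subseteq> Q}"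

lemma class_of_eq:
  assumes "partition_on UNIV \<pi>" "P \<in> \<pi>" "x \<in> P"
  shows "class_of \<pi> x = P"
  unfolding class_of_def
proof (rule the_equality)
  fix R assume "R \<in> \<pi> \<and> x \<in> R"
  then show "R = P" using assms unfolding partition_on_def disjoint_def by blast
qed (use assms in blast)

lemma class_of_in:
  assumes "partition_on UNIV \<pi>"
  shows "class_of \<pi> x \<in> \<pi>" "x \<in> class_of \<pi> x"
proof -
  obtain P where "P \<in> \<pi>" "x \<in> P" using assms unfolding partition_on_def by blast
  then show "class_of \<pi> x \<in> \<pi>" "x \<in> class_of \<pi> x" using class_of_eq[OF assms] by auto
qed

lemma bar_related:
  assumes "partition_on UNIV \<pi>"
  shows "(\<forall>\<alpha>\<in>bar \<pi>. \<alpha> x = \<alpha> y) \<longleftrightarrow> class_of \<pi> x = class_of \<pi> y" (is "?L = ?R")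
proof
  assume ?R
  then show ?L using class_of_in[OF assms] unfolding bar_def by blast
next
  assume L: ?L
  show ?R
  proof (rule ccontr)
    assume n: "\<not> ?R"
    then have xy: "x \<noteq> y" by auto
    let ?a = "\<lambda>z. if class_of \<pi> z = class_of \<pi> x then x else y"
    have "?a \<in> bar \<pi>" unfolding bar_def using class_of_eq[OF assms] by auto
    then have "?a x = ?a y" using L by (rule bspec[rotated])
    with n xy show False by (simp split: if_splits)
  qed
qed

lemma class_nonempty: "partition_on UNIV \<pi> \<Longrightarrow> P \<in> \<pi> \<Longrightarrow> \<exists>x. x \<in> P"
  unfolding partition_on_def by (metis ex_in_conv)

lemma part_eq_classes:
  assumes "partition_on UNIV \<pi>"
  shows "\<pi> = range (class_of \<pi>)"
proof -
  have "P \<in> range (class_of \<pi>)" if "P \<in> \<pi>" for P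
  proof -
    obtain x where "x \<in> P" using class_nonempty[OF assms \<open>P \<in> \<pi>\<close>] by blast
    then show ?thesis using class_of_eq[OF assms that] by blast
  qed
  then show ?thesis using class_of_in[OF assms] by blast
qed

lemma class_of_mem:
  assumes "partition_on UNIV \<pi>"
  shows "class_of \<pi> x = {y. class_of \<pi> x = class_of \<pi> y}"
  using class_of_in[OF assms] class_of_eq[OF assms] by blast

lemma bar_inj:
  assumes "partition_on UNIV \<pi>" "partition_on UNIV \<pi>'" "bar \<pi> = bar \<pi>'"
  shows "\<pi> = \<pi>'"
proof -
  have "class_of \<pi> x = class_of \<pi>' x" for x
    using class_of_mem[OF assms(1), of x] class_of_mem[OF assms(2), of x]
      bar_related[OF assms(1)] bar_related[OF assms(2)] assms(3) by auto
  then show ?thesis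
    using part_eq_classes[OF assms(1)] part_eq_classes[OF assms(2)] by auto
qed

lemma part_of_bar:
  assumes "partition_on UNIV \<pi>"
  shows "part_of (bar \<pi>) = \<pi>"
  unfolding part_of_def by (rule the_equality) (use assms bar_inj in blast)+

lemma star_apply:
  assumes "partition_on UNIV \<pi>1" "partition_on UNIV \<pi>2" "\<eta> \<in> \<pi>2 \<rightarrow>\<^sub>E \<pi>1" "\<alpha> \<in> bar \<pi>1"
    "y \<in> \<eta> (class_of \<pi>2 x)"
  shows "star \<pi>1 \<pi>2 \<eta> \<alpha> x = \<alpha> y"
proof -
  have "\<eta> (class_of \<pi>2 x) \<in> \<pi>1" using assms(3) class_of_in[OF assms(2)] by blast
  then have "\<alpha> ` \<eta> (class_of \<pi>2 x) = {\<alpha> y}" using assms(4,5) unfolding bar_def by blast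
  then show ?thesis using assms(4) by (simp add: star_def)
qed

lemma star_inj:
  assumes p: "partition_on UNIV \<pi>1" "partition_on UNIV \<pi>2"
    and e: "\<eta> \<in> \<pi>2 \<rightarrow>\<^sub>E \<pi>1" and e': "\<eta>' \<in> \<pi>2 \<rightarrow>\<^sub>E \<pi>1" and eq: "star \<pi>1 \<pi>2 \<eta> = star \<pi>1 \<pi>2 \<eta>'"
  shows "\<eta> = \<eta>'"
proof (rule PiE_ext[OF e e'])
  fix R assume R: "R \<in> \<pi>2"
  then obtain x where x: "x \<in> R" using class_nonempty[OF p(2)] by blast
  have cx: "class_of \<pi>2 x = R" using class_of_eq[OF p(2) R x] .
  have m: "\<eta> R \<in> \<pi>1" "\<eta>' R \<in> \<pi>1" using e e' R by auto
  then obtain y y' where y: "y \<in> \<eta> R" "y' \<in> \<eta>' R" using class_nonempty[OF p(1)] by blast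
  have "\<forall>\<alpha>\<in>bar \<pi>1. \<alpha> y = \<alpha> y'"
  proof
    fix \<alpha> assume b: "\<alpha> \<in> bar \<pi>1"
    show "\<alpha> y = \<alpha> y'"
      using star_apply[OF p e b, of y x] star_apply[OF p e' b, of y' x] eq cx y by simp
  qed
  then show "\<eta> R = \<eta>' R"
    using bar_related[OF p(1)] class_of_eq[OF p(1)] m y by metis
qed

lemma unstar_star:
  assumes "partition_on UNIV \<pi>1" "partition_on UNIV \<pi>2" "\<eta> \<in> \<pi>2 \<rightarrow>\<^sub>E \<pi>1"
  shows "unstar \<pi>1 \<pi>2 (star \<pi>1 \<pi>2 \<eta>) = \<eta>"
  unfolding unstar_def by (rule the_equality) (use assms star_inj in blast)+

lemma fibres_partition: "partition_on UNIV (fibres a)"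
  unfolding fibres_def partition_on_def disjoint_def by auto

lemma separates_fibres: "separates (fibres \<theta>) A \<longleftrightarrow> inj_on \<theta> A"
  unfolding separates_def fibres_def inj_on_def by auto

lemma bar_fibres_subset: "bar (fibres a) \<subseteq> bar \<pi> \<longleftrightarrow> a \<in> bar \<pi>"
proof
  assume "bar (fibres a) \<subseteq> bar \<pi>"
  moreover have "a \<in> bar (fibres a)" unfolding bar_def fibres_def by auto
  ultimately show "a \<in> bar \<pi>" by (rule subsetD)
next
  assume a: "a \<in> bar \<pi>"
  show "bar (fibres a) \<subseteq> bar \<pi>"
  proof
    fix b assume b: "b \<in> bar (fibres a)"
    have ab: "b x = b y" if "a x = a y" for x y
    proof -
      have "a -` {a y} \<in> fibres a" by (simp add: fibres_def)
      moreover have "x \<in> a -` {a y}" "y \<in> a -` {a y}" using that by auto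
      ultimately show ?thesis using b[unfolded bar_def mem_Collect_eq, rule_format] by metis
    qed
    show "b \<in> bar \<pi>" unfolding bar_def
    proof (intro CollectI ballI)
      fix P x y assume *: "P \<in> \<pi>" "x \<in> P" "y \<in> P"
      have "a x = a y" using a[unfolded bar_def mem_Collect_eq, rule_format, OF *] .
      then show "b x = b y" by (rule ab)
    qed
  qed
qed

lemma bar_inv_image:
  "a \<in> bar (inv_image_part \<theta> \<pi>) \<longleftrightarrow> (\<forall>P\<in>\<pi>. \<forall>x y. \<theta> x \<in> P \<longrightarrow> \<theta> y \<in> P \<longrightarrow> a x = a y)"
  unfolding bar_def inv_image_part_def by auto

lemma cs_in_P:
  assumes p: "partition_on UNIV \<pi>" and s: "saturates (range \<theta>) \<pi>"
    and c: "cross_section C (inv_image_part \<theta> \<pi>)"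
  shows "C \<in> Obj (P_cat \<theta>)" "cross_section (\<theta> ` C) \<pi>" "inj_on \<theta> C"
proof -
  have c': "\<exists>!x. x \<in> C \<and> \<theta> x \<in> P" if "P \<in> \<pi>" for P
    using c that unfolding cross_section_def inv_image_part_def by auto
  have "\<pi> \<noteq> {}" using p unfolding partition_on_def by blast
  then have ne: "C \<noteq> {}" using c' by blast
  show inj: "inj_on \<theta> C"
  proof (rule inj_onI)
    fix x y assume "x \<in> C" "y \<in> C" "\<theta> x = \<theta> y"
    then show "x = y" using c'[OF class_of_in(1)[OF p, of "\<theta> x"]] class_of_in(2)[OF p, of "\<theta> x"] by auto
  qed
  show "C \<in> Obj (P_cat \<theta>)" using ne inj by (simp add: P_cat_def separates_fibres)
  show "cross_section (\<theta> ` C) \<pi>" unfolding cross_section_def using c' by blast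
qed

lemma chosen_cs:
  assumes p: "partition_on UNIV \<pi>" and s: "saturates (range \<theta>) \<pi>"
  shows "chosen_cs \<theta> \<pi> \<in> Obj (P_cat \<theta>)" "cross_section (chosen_cs \<theta> \<pi>) (inv_image_part \<theta> \<pi>)"
proof -
  let ?f = "\<lambda>P. SOME x. \<theta> x \<in> P"
  have f: "\<theta> (?f P) \<in> P" if "P \<in> \<pi>" for P
  proof (rule someI_ex)
    show "\<exists>x. \<theta> x \<in> P" using s that unfolding saturates_def by blast
  qed
  have "cross_section (?f ` \<pi>) (inv_image_part \<theta> \<pi>)"
    unfolding cross_section_def inv_image_part_def
  proof clarify
    fix P assume P: "P \<in> \<pi>"
    show "\<exists>!x. x \<in> ?f ` \<pi> \<inter> \<theta> -` P"
    proof (rule ex1I)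
      show "?f P \<in> ?f ` \<pi> \<inter> \<theta> -` P" using f[OF P] P by blast
      fix x assume "x \<in> ?f ` \<pi> \<inter> \<theta> -` P"
      then obtain R where R: "R \<in> \<pi>" "x = ?f R" "\<theta> x \<in> P" by blast
      then have "R = P" using f[OF R(1)] class_of_eq[OF p] P by metis
      then show "x = ?f P" using R by simp
    qed
  qed
  then have "\<exists>C. C \<in> Obj (P_cat \<theta>) \<and> cross_section C (inv_image_part \<theta> \<pi>)"
    using cs_in_P(1)[OF p s] by blast
  then have "chosen_cs \<theta> \<pi> \<in> Obj (P_cat \<theta>) \<and> cross_section (chosen_cs \<theta> \<pi>) (inv_image_part \<theta> \<pi>)"
    unfolding chosen_cs_def by (rule someI_ex)
  then show "chosen_cs \<theta> \<pi> \<in> Obj (P_cat \<theta>)"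
    "cross_section (chosen_cs \<theta> \<pi>) (inv_image_part \<theta> \<pi>)" by blast+
qed

lemma cs_map_in:
  assumes "partition_on UNIV \<pi>2" "\<eta> \<in> \<pi>2 \<rightarrow>\<^sub>E \<pi>1" "cross_section D \<pi>1"
  shows "cs_map \<pi>2 \<eta> D x \<in> D" "cs_map \<pi>2 \<eta> D x \<in> \<eta> (class_of \<pi>2 x)"
proof -
  have "\<eta> (class_of \<pi>2 x) \<in> \<pi>1" using assms(2) class_of_in[OF assms(1)] by blast
  then have "\<exists>!d. d \<in> D \<inter> \<eta> (class_of \<pi>2 x)" using assms(3) unfolding cross_section_def by blast
  then have "cs_map \<pi>2 \<eta> D x \<in> D \<inter> \<eta> (class_of \<pi>2 x)" unfolding cs_map_def by (rule theI')
  then show "cs_map \<pi>2 \<eta> D x \<in> D" "cs_map \<pi>2 \<eta> D x \<in> \<eta> (class_of \<pi>2 x)" by blast+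
qed

lemma Gamma_formula:
  assumes p: "partition_on UNIV \<pi>1" "saturates (range \<theta>) \<pi>1" "partition_on UNIV \<pi>2"
    and e: "\<eta> \<in> \<pi>2 \<rightarrow>\<^sub>E \<pi>1" and a: "a \<in> on_obj (Gamma \<theta>) (A, bar \<pi>1)"
    and c: "cross_section C (inv_image_part \<theta> \<pi>1)"
    and y: "\<theta> y \<in> \<eta> (class_of \<pi>2 (\<theta> x))"
  shows "(\<theta> \<Zcomp> cs_map \<pi>2 \<eta> (\<theta> ` C) \<Zcomp> inv_into C \<theta> \<Zcomp> a \<Zcomp> f) x = f (a y)"
proof -
  let ?d = "cs_map \<pi>2 \<eta> (\<theta> ` C) (\<theta> x)"
  note d = cs_map_in[OF p(3) e cs_in_P(2)[OF p(1,2) c], of "\<theta> x"]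
  have "a \<in> bar (inv_image_part \<theta> \<pi>1)"
    using a part_of_bar[OF p(1)] by (simp add: Gamma_def theta_star_def bar_fibres_subset)
  moreover have "\<theta> (inv_into C \<theta> ?d) \<in> \<eta> (class_of \<pi>2 (\<theta> x))"
    using d f_inv_into_f[OF d(1)] by simp
  moreover have "\<eta> (class_of \<pi>2 (\<theta> x)) \<in> \<pi>1" using e class_of_in[OF p(3)] by blast
  ultimately have "a (inv_into C \<theta> ?d) = a y" using y unfolding bar_inv_image by blast
  then show ?thesis by (simp add: rcomp_def)
qed

lemma Gamma_mor_indep:
  assumes p: "partition_on UNIV \<pi>1" "saturates (range \<theta>) \<pi>1"
      "partition_on UNIV \<pi>2" "saturates (range \<theta>) \<pi>2"
    and e: "\<eta> \<in> \<pi>2 \<rightarrow>\<^sub>E \<pi>1" and a: "a \<in> on_obj (Gamma \<theta>) (A, bar \<pi>1)"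
    and c: "cross_section C (inv_image_part \<theta> \<pi>1)"
  shows "on_mor (Gamma \<theta>) (A, bar \<pi>1) (B, bar \<pi>2) (f, star \<pi>1 \<pi>2 \<eta>) a =
    \<theta> \<Zcomp> cs_map \<pi>2 \<eta> (\<theta> ` C) \<Zcomp> inv_into C \<theta> \<Zcomp> a \<Zcomp> f"
proof
  fix x
  have "\<eta> (class_of \<pi>2 (\<theta> x)) \<in> \<pi>1" using e class_of_in[OF p(3)] by blast
  then obtain y where y: "\<theta> y \<in> \<eta> (class_of \<pi>2 (\<theta> x))" using p(2) unfolding saturates_def by blast
  show "on_mor (Gamma \<theta>) (A, bar \<pi>1) (B, bar \<pi>2) (f, star \<pi>1 \<pi>2 \<eta>) a x =
    (\<theta> \<Zcomp> cs_map \<pi>2 \<eta> (\<theta> ` C) \<Zcomp> inv_into C \<theta> \<Zcomp> a \<Zcomp> f) x"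
    using Gamma_formula[OF p(1-3) e a c y, of f] Gamma_formula[OF p(1-3) e a chosen_cs(2)[OF p(1,2)] y, of f]
    by (simp add: Gamma_def Let_def part_of_bar p unstar_star e)
qed

lemma Delta_formula:
  assumes p: "partition_on UNIV \<pi>1" "partition_on UNIV \<pi>2"
    and e: "\<eta> \<in> \<pi>2 \<rightarrow>\<^sub>E \<pi>1" and a: "a \<in> on_obj (Delta \<theta>) (A, bar \<pi>1)"
    and c: "cross_section D \<pi>1" and y: "y \<in> \<eta> (class_of \<pi>2 x)"
  shows "(cs_map \<pi>2 \<eta> D \<Zcomp> a \<Zcomp> inv_into A \<theta> \<Zcomp> f \<Zcomp> \<theta>) x = \<theta> (f (inv_into A \<theta> (a y)))"
proof -
  have "a \<in> bar \<pi>1" using a by (simp add: Delta_def bar_fibres_subset)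
  moreover have "\<eta> (class_of \<pi>2 x) \<in> \<pi>1" using e class_of_in[OF p(2)] by blast
  ultimately have "a (cs_map \<pi>2 \<eta> D x) = a y"
    using cs_map_in(2)[OF p(2) e c, of x] y unfolding bar_def by blast
  then show ?thesis by (simp add: rcomp_def)
qed

lemma Delta_mor_indep:
  assumes p: "partition_on UNIV \<pi>1" "saturates (range \<theta>) \<pi>1"
      "partition_on UNIV \<pi>2" "saturates (range \<theta>) \<pi>2"
    and e: "\<eta> \<in> \<pi>2 \<rightarrow>\<^sub>E \<pi>1" and a: "a \<in> on_obj (Delta \<theta>) (A, bar \<pi>1)"
    and c: "cross_section D \<pi>1"
  shows "on_mor (Delta \<theta>) (A, bar \<pi>1) (B, bar \<pi>2) (f, star \<pi>1 \<pi>2 \<eta>) a =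
    cs_map \<pi>2 \<eta> D \<Zcomp> a \<Zcomp> inv_into A \<theta> \<Zcomp> f \<Zcomp> \<theta>"
proof
  fix x
  have "\<eta> (class_of \<pi>2 x) \<in> \<pi>1" using e class_of_in[OF p(3)] by blast
  then obtain y where y: "y \<in> \<eta> (class_of \<pi>2 x)" using class_nonempty[OF p(1)] by blast
  have c': "cross_section (\<theta> ` chosen_cs \<theta> \<pi>1) \<pi>1"
    using cs_in_P(2)[OF p(1,2) chosen_cs(2)[OF p(1,2)]] .
  show "on_mor (Delta \<theta>) (A, bar \<pi>1) (B, bar \<pi>2) (f, star \<pi>1 \<pi>2 \<eta>) a x =
    (cs_map \<pi>2 \<eta> D \<Zcomp> a \<Zcomp> inv_into A \<theta> \<Zcomp> f \<Zcomp> \<theta>) x"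
    using Delta_formula[OF p(1,3) e a c y, of f] Delta_formula[OF p(1,3) e a c' y, of f]
    by (simp add: Delta_def Let_def part_of_bar p unstar_star e)
qed

end

theory Submission
  imports Defs
begin

text \<open>An element of \<open>\<Gamma>\<^sub>\<theta>(A, bar \<pi>)\<close> is \<open>\<theta>a\<close> for a unique \<open>a\<close> with image in \<open>A\<close> that is constant on the
  classes of \<open>\<pi>\<close>, since the image of \<open>\<theta>\<close> meets each class; such an \<open>a\<close> is automatically regular.
  Hence \<open>\<theta>a \<mapsto> a\<theta>\<close> is well defined, and it is visibly a natural isomorphism. Conversely, any natural
  isomorphism sends the only element of \<open>\<Gamma>\<^sub>\<theta>({p}, Q)\<close>, a constant map, to the only element of
  \<open>\<Delta>\<^sub>\<theta>({p}, Q)\<close>. The inclusions \<open>{p} \<rightarrow> A\<close> then determine it at the partition with one class, and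
  the maps from that partition to \<open>\<pi>\<close> selecting a class determine its values at \<open>(A, bar \<pi>)\<close> pointwise.\<close>

section \<open>Objects and morphisms of the two categories in terms of sets and partitions\<close>

text \<open>Objects of \<open>Pi_cat\<close> are sets of maps \<open>bar \<pi>\<close>, but the
  arguments run on the underlying partitions; \<open>part_of_bar\<close> makes the passage between
  the two lossless.\<close>

definition sat_partition :: "('x \<Rightarrow> 'x) \<Rightarrow> 'x set set \<Rightarrow> bool"
  where "sat_partition \<theta> \<pi> \<longleftrightarrow> partition_on UNIV \<pi> \<and> saturates (range \<theta>) \<pi>"

lemma sat_partitionD:
  assumes "sat_partition \<theta> \<pi>"
  shows "partition_on UNIV \<pi>" "saturates (range \<theta>) \<pi>"
  using assms by (auto simp: sat_partition_def)

lemma P_cat_obj: "A \<in> Obj (P_cat \<theta>) \<longleftrightarrow> A \<noteq> {} \<and> inj_on \<theta> A"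
  by (simp add: P_cat_def separates_fibres)

lemma P_cat_hom: "f \<in> Hom (P_cat \<theta>) A B \<longleftrightarrow> f \<in> A \<rightarrow>\<^sub>E B"
  by (simp add: P_cat_def)

lemma Pi_cat_objE:
  assumes "Q \<in> Obj (Pi_cat \<theta>)"
  obtains \<pi> where "Q = bar \<pi>" "sat_partition \<theta> \<pi>"
  using assms by (auto simp: Pi_cat_def sat_partition_def)

lemma Pi_cat_objI: "sat_partition \<theta> \<pi> \<Longrightarrow> bar \<pi> \<in> Obj (Pi_cat \<theta>)"
  by (auto simp: Pi_cat_def sat_partition_def)

lemma Pi_cat_hom:
  assumes "sat_partition \<theta> \<pi>1" "sat_partition \<theta> \<pi>2"
  shows "Hom (Pi_cat \<theta>) (bar \<pi>1) (bar \<pi>2) = star \<pi>1 \<pi>2 ` (\<pi>2 \<rightarrow>\<^sub>E \<pi>1)"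
  using sat_partitionD[OF assms(1)] sat_partitionD[OF assms(2)]
  by (simp add: Pi_cat_def part_of_bar)

lemma bar_eqD:
  assumes "\<alpha> \<in> bar \<pi>" "P \<in> \<pi>" "x \<in> P" "y \<in> P"
  shows "\<alpha> x = \<alpha> y"
  using assms unfolding bar_def by blast

lemma rcomp_mem_bar:
  assumes "\<alpha> \<in> bar \<pi>"
  shows "\<alpha> \<Zcomp> h \<in> bar \<pi>"
  unfolding bar_def rcomp_def using bar_eqD[OF assms] by (intro CollectI ballI arg_cong[where f = h])

lemma barI_class:
  assumes "partition_on UNIV \<pi>" "\<And>x y. class_of \<pi> x = class_of \<pi> y \<Longrightarrow> \<alpha> x = \<alpha> y"
  shows "\<alpha> \<in> bar \<pi>"
  unfolding bar_def using assms class_of_eq[OF assms(1)] by blast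

lemma sat_obtain:
  assumes "sat_partition \<theta> \<pi>" "P \<in> \<pi>"
  obtains y where "\<theta> y \<in> P"
  using assms unfolding sat_partition_def saturates_def by blast

section \<open>Contravariant functoriality of \<open>star\<close>\<close>

lemma star_mem_bar:
  assumes "partition_on UNIV \<pi>1" "partition_on UNIV \<pi>2" "\<eta> \<in> \<pi>2 \<rightarrow>\<^sub>E \<pi>1" "\<alpha> \<in> bar \<pi>1"
  shows "star \<pi>1 \<pi>2 \<eta> \<alpha> \<in> bar \<pi>2"
  by (rule barI_class[OF assms(2)]) (simp add: star_def assms)

text \<open>Morphisms of \<open>Pi_cat\<close> are images under \<open>star\<close>, while its
  identities are given directly as maps; this supplies the map of classes behind an
  identity.\<close>

lemma star_identity:
  assumes p: "partition_on UNIV \<pi>"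
  shows "star \<pi> \<pi> (\<lambda>P\<in>\<pi>. P) = (\<lambda>\<alpha>\<in>bar \<pi>. \<alpha>)"
proof
  fix \<alpha>
  have "star \<pi> \<pi> (\<lambda>P\<in>\<pi>. P) \<alpha> = \<alpha>" if "\<alpha> \<in> bar \<pi>"
    using star_apply[OF p p _ that] class_of_in[OF p] by (intro ext) auto
  \<comment> \<open>Outside \<open>bar \<pi>\<close> both sides are
    \<open>undefined\<close>.\<close>
  then show "star \<pi> \<pi> (\<lambda>P\<in>\<pi>. P) \<alpha> = (\<lambda>\<alpha>\<in>bar \<pi>. \<alpha>) \<alpha>" by (auto simp: star_def)
qed

text \<open>By \<open>star_apply\<close>, a value of \<open>star\<close> may be computed at any
  representative of the selected class. With one \<open>z\<close> taken from the class reached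
  through \<open>\<eta>'\<close> and then \<open>\<eta>\<close>, both sides are
  \<open>\<alpha> z\<close>.\<close>

lemma star_compose:
  assumes p: "partition_on UNIV \<pi>1" "partition_on UNIV \<pi>2" "partition_on UNIV \<pi>3"
    and e: "\<eta> \<in> \<pi>2 \<rightarrow>\<^sub>E \<pi>1" and e': "\<eta>' \<in> \<pi>3 \<rightarrow>\<^sub>E \<pi>2"
  shows "compose (bar \<pi>1) (star \<pi>2 \<pi>3 \<eta>') (star \<pi>1 \<pi>2 \<eta>) = star \<pi>1 \<pi>3 (compose \<pi>3 \<eta> \<eta>')"
proof
  fix \<alpha>
  have "star \<pi>2 \<pi>3 \<eta>' (star \<pi>1 \<pi>2 \<eta> \<alpha>) = star \<pi>1 \<pi>3 (compose \<pi>3 \<eta> \<eta>') \<alpha>" if a: "\<alpha> \<in> bar \<pi>1"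
  proof
    fix x
    have c3: "class_of \<pi>3 x \<in> \<pi>3" using class_of_in[OF p(3)] by blast
    then have c2: "\<eta>' (class_of \<pi>3 x) \<in> \<pi>2" using e' by blast
    then obtain y where y: "y \<in> \<eta>' (class_of \<pi>3 x)" using class_nonempty[OF p(2)] by blast
    \<comment> \<open>The representative \<open>y\<close> stands for the whole class chosen by
      \<open>\<eta>'\<close>, so the inner \<open>star\<close> evaluated at \<open>y\<close> applies
      \<open>\<eta>\<close> to exactly that class.\<close>
    have cy: "class_of \<pi>2 y = \<eta>' (class_of \<pi>3 x)" using class_of_eq[OF p(2) c2 y] .
    have "\<eta> (class_of \<pi>2 y) \<in> \<pi>1" using c2 cy e by auto
    then obtain z where z: "z \<in> \<eta> (class_of \<pi>2 y)" using class_nonempty[OF p(1)] by blast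
    have c: "compose \<pi>3 \<eta> \<eta>' \<in> \<pi>3 \<rightarrow>\<^sub>E \<pi>1" using e e' by (auto simp: compose_def)
    have "star \<pi>2 \<pi>3 \<eta>' (star \<pi>1 \<pi>2 \<eta> \<alpha>) x = \<alpha> z"
      using star_apply[OF p(2,3) e' star_mem_bar[OF p(1,2) e a] y] star_apply[OF p(1,2) e a z] by simp
    moreover have "star \<pi>1 \<pi>3 (compose \<pi>3 \<eta> \<eta>') \<alpha> x = \<alpha> z"
      by (rule star_apply[OF p(1,3) c a]) (use z cy c3 in \<open>simp add: compose_def\<close>)
    ultimately show "star \<pi>2 \<pi>3 \<eta>' (star \<pi>1 \<pi>2 \<eta> \<alpha>) x = star \<pi>1 \<pi>3 (compose \<pi>3 \<eta> \<eta>') \<alpha> x" by simp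
  qed
  then show "compose (bar \<pi>1) (star \<pi>2 \<pi>3 \<eta>') (star \<pi>1 \<pi>2 \<eta>) \<alpha> = star \<pi>1 \<pi>3 (compose \<pi>3 \<eta> \<eta>') \<alpha>"
    by (auto simp: compose_def star_def)
qed

section \<open>Category axioms\<close>

lemma category_P_cat: "category (P_cat \<theta>)"
  unfolding category_def
proof (intro conjI ballI)
  fix A B f assume "f \<in> Hom (P_cat \<theta>) A B"
  then have f: "f \<in> A \<rightarrow>\<^sub>E B" by (simp add: P_cat_hom)
  \<comment> \<open>Composites are cut down to the source, so the unit laws also use that
    \<open>f\<close> is already \<open>undefined\<close> outside \<open>A\<close>.\<close>
  then show "Comp (P_cat \<theta>) A A B (Id (P_cat \<theta>) A) f = f" "Comp (P_cat \<theta>) A B B f (Id (P_cat \<theta>) B) = f"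
    by (auto simp: P_cat_def compose_def PiE_def Pi_def extensional_def restrict_def fun_eq_iff)
next
  fix A B C D f g h
  assume "f \<in> Hom (P_cat \<theta>) A B"
  then show "Comp (P_cat \<theta>) A C D (Comp (P_cat \<theta>) A B C f g) h
      = Comp (P_cat \<theta>) A B D f (Comp (P_cat \<theta>) B C D g h)"
    by (auto simp: P_cat_def compose_def fun_eq_iff)
qed (auto simp: P_cat_def compose_def)

lemma category_Pi_cat: "category (Pi_cat \<theta>)"
  unfolding category_def
proof (intro conjI ballI)
  fix Q assume "Q \<in> Obj (Pi_cat \<theta>)"
  then obtain \<pi> where Q: "Q = bar \<pi>" "sat_partition \<theta> \<pi>" by (rule Pi_cat_objE)
  have "star \<pi> \<pi> (\<lambda>P\<in>\<pi>. P) \<in> Hom (Pi_cat \<theta>) Q Q" unfolding Q(1) Pi_cat_hom[OF Q(2) Q(2)] by auto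
  then show "Id (Pi_cat \<theta>) Q \<in> Hom (Pi_cat \<theta>) Q Q"
    using star_identity[OF sat_partitionD(1)[OF Q(2)]] Q by (simp add: Pi_cat_def)
next
  fix Q1 Q2 Q3 h k
  assume obj: "Q1 \<in> Obj (Pi_cat \<theta>)" "Q2 \<in> Obj (Pi_cat \<theta>)" "Q3 \<in> Obj (Pi_cat \<theta>)"
    and h: "h \<in> Hom (Pi_cat \<theta>) Q1 Q2" and k: "k \<in> Hom (Pi_cat \<theta>) Q2 Q3"
  obtain \<pi>1 where 1: "Q1 = bar \<pi>1" "sat_partition \<theta> \<pi>1" using obj(1) by (rule Pi_cat_objE)
  obtain \<pi>2 where 2: "Q2 = bar \<pi>2" "sat_partition \<theta> \<pi>2" using obj(2) by (rule Pi_cat_objE)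
  obtain \<pi>3 where 3: "Q3 = bar \<pi>3" "sat_partition \<theta> \<pi>3" using obj(3) by (rule Pi_cat_objE)
  obtain \<eta> where e: "\<eta> \<in> \<pi>2 \<rightarrow>\<^sub>E \<pi>1" "h = star \<pi>1 \<pi>2 \<eta>" using h 1 2 by (auto simp: Pi_cat_hom)
  obtain \<eta>' where e': "\<eta>' \<in> \<pi>3 \<rightarrow>\<^sub>E \<pi>2" "k = star \<pi>2 \<pi>3 \<eta>'" using k 2 3 by (auto simp: Pi_cat_hom)
  have "Comp (Pi_cat \<theta>) Q1 Q2 Q3 h k = star \<pi>1 \<pi>3 (compose \<pi>3 \<eta> \<eta>')"
    using star_compose[OF sat_partitionD(1)[OF 1(2)] sat_partitionD(1)[OF 2(2)]
        sat_partitionD(1)[OF 3(2)] e(1) e'(1)] e e' 1 by (simp add: Pi_cat_def)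
  moreover have "compose \<pi>3 \<eta> \<eta>' \<in> \<pi>3 \<rightarrow>\<^sub>E \<pi>1" using e e' by (auto simp: compose_def)
  ultimately show "Comp (Pi_cat \<theta>) Q1 Q2 Q3 h k \<in> Hom (Pi_cat \<theta>) Q1 Q3"
    using 1 3 by (simp add: Pi_cat_hom)
next
  fix Q1 Q2 h assume obj: "Q1 \<in> Obj (Pi_cat \<theta>)" "Q2 \<in> Obj (Pi_cat \<theta>)" and h: "h \<in> Hom (Pi_cat \<theta>) Q1 Q2"
  obtain \<pi>1 where 1: "Q1 = bar \<pi>1" "sat_partition \<theta> \<pi>1" using obj(1) by (rule Pi_cat_objE)
  obtain \<pi>2 where 2: "Q2 = bar \<pi>2" "sat_partition \<theta> \<pi>2" using obj(2) by (rule Pi_cat_objE)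
  obtain \<eta> where e: "\<eta> \<in> \<pi>2 \<rightarrow>\<^sub>E \<pi>1" "h = star \<pi>1 \<pi>2 \<eta>" using h 1 2 by (auto simp: Pi_cat_hom)
  have "h \<alpha> \<in> Q2" if "\<alpha> \<in> Q1" for \<alpha>
    using star_mem_bar[OF sat_partitionD(1)[OF 1(2)] sat_partitionD(1)[OF 2(2)] e(1)] e 1 2 that by simp
  \<comment> \<open>As in \<open>P_cat\<close>, the unit laws compare extensional maps, so the
    default value off \<open>Q1\<close> has to agree as well.\<close>
  moreover have "h \<alpha> = undefined" if "\<alpha> \<notin> Q1" for \<alpha> using that e 1 by (simp add: star_def)
  ultimately show "Comp (Pi_cat \<theta>) Q1 Q1 Q2 (Id (Pi_cat \<theta>) Q1) h = h"
    "Comp (Pi_cat \<theta>) Q1 Q2 Q2 h (Id (Pi_cat \<theta>) Q2) = h"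
    by (auto simp: Pi_cat_def compose_def restrict_def fun_eq_iff)
next
  fix Q1 Q2 Q3 Q4 h k l
  assume obj: "Q1 \<in> Obj (Pi_cat \<theta>)" "Q2 \<in> Obj (Pi_cat \<theta>)" and h: "h \<in> Hom (Pi_cat \<theta>) Q1 Q2"
  obtain \<pi>1 where 1: "Q1 = bar \<pi>1" "sat_partition \<theta> \<pi>1" using obj(1) by (rule Pi_cat_objE)
  obtain \<pi>2 where 2: "Q2 = bar \<pi>2" "sat_partition \<theta> \<pi>2" using obj(2) by (rule Pi_cat_objE)
  obtain \<eta> where e: "\<eta> \<in> \<pi>2 \<rightarrow>\<^sub>E \<pi>1" "h = star \<pi>1 \<pi>2 \<eta>" using h 1 2 by (auto simp: Pi_cat_hom)
  \<comment> \<open>The composite of \<open>k\<close> and \<open>l\<close> is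
    \<open>undefined\<close> off \<open>Q2\<close>; associativity therefore rests on
    \<open>h\<close> landing in \<open>Q2\<close>.\<close>
  have "h \<alpha> \<in> Q2" if "\<alpha> \<in> Q1" for \<alpha>
    using star_mem_bar[OF sat_partitionD(1)[OF 1(2)] sat_partitionD(1)[OF 2(2)] e(1)] e 1 2 that by simp
  then show "Comp (Pi_cat \<theta>) Q1 Q3 Q4 (Comp (Pi_cat \<theta>) Q1 Q2 Q3 h k) l
      = Comp (Pi_cat \<theta>) Q1 Q2 Q4 h (Comp (Pi_cat \<theta>) Q2 Q3 Q4 k l)"
    by (auto simp: Pi_cat_def compose_def restrict_def fun_eq_iff)
qed

lemma category_prod_cat:
  assumes "category C" "category D"
  shows "category (prod_cat C D)"
  using assms unfolding category_def prod_cat_def by (simp add: split_paired_all)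

section \<open>Pointwise description of the two bifunctors\<close>

lemma Gamma_obj:
  assumes "sat_partition \<theta> \<pi>"
  shows "a \<in> on_obj (Gamma \<theta>) (A, bar \<pi>) \<longleftrightarrow>
    range a \<subseteq> A \<and> (\<forall>P\<in>\<pi>. \<forall>x y. \<theta> x \<in> P \<longrightarrow> \<theta> y \<in> P \<longrightarrow> a x = a y)"
  by (simp add: Gamma_def theta_star_def bar_fibres_subset bar_inv_image
      part_of_bar[OF sat_partitionD(1)[OF assms]])

lemma Gamma_objD:
  assumes "sat_partition \<theta> \<pi>" "a \<in> on_obj (Gamma \<theta>) (A, bar \<pi>)" "P \<in> \<pi>" "\<theta> x \<in> P" "\<theta> y \<in> P"
  shows "a x = a y"
  using assms(2-) unfolding Gamma_obj[OF assms(1)] by blast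

lemma Delta_obj: "a \<in> on_obj (Delta \<theta>) (A, bar \<pi>) \<longleftrightarrow> range a \<subseteq> \<theta> ` A \<and> a \<in> bar \<pi>"
  by (simp add: Delta_def bar_fibres_subset)

text \<open>The chosen cross-section disappears: \<open>a\<close> is constant on the preimage under
  \<open>\<theta>\<close> of each class of \<open>\<pi>1\<close>, so any \<open>y\<close> in the
  preimage of the class picked by \<open>\<eta>\<close> gives the value. The functor laws and
  naturality are computed from this and \<open>Delta_mor\<close>.\<close>

lemma Gamma_mor:
  assumes p: "sat_partition \<theta> \<pi>1" "sat_partition \<theta> \<pi>2"
    and e: "\<eta> \<in> \<pi>2 \<rightarrow>\<^sub>E \<pi>1" and a: "a \<in> on_obj (Gamma \<theta>) (A, bar \<pi>1)"
    and y: "\<theta> y \<in> \<eta> (class_of \<pi>2 (\<theta> x))"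
  shows "on_mor (Gamma \<theta>) (A, bar \<pi>1) (B, bar \<pi>2) (f, star \<pi>1 \<pi>2 \<eta>) a x = f (a y)"
  using Gamma_mor_indep[OF sat_partitionD[OF p(1)] sat_partitionD[OF p(2)] e a
      chosen_cs(2)[OF sat_partitionD[OF p(1)]]]
    Gamma_formula[OF sat_partitionD[OF p(1)] sat_partitionD(1)[OF p(2)] e a
      chosen_cs(2)[OF sat_partitionD[OF p(1)]] y]
  by simp

lemma Delta_mor:
  assumes p: "sat_partition \<theta> \<pi>1" "sat_partition \<theta> \<pi>2"
    and e: "\<eta> \<in> \<pi>2 \<rightarrow>\<^sub>E \<pi>1" and a: "a \<in> on_obj (Delta \<theta>) (A, bar \<pi>1)"
    and y: "y \<in> \<eta> (class_of \<pi>2 x)"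
  shows "on_mor (Delta \<theta>) (A, bar \<pi>1) (B, bar \<pi>2) (f, star \<pi>1 \<pi>2 \<eta>) a x
    = \<theta> (f (inv_into A \<theta> (a y)))"
proof -
  have c: "cross_section (\<theta> ` chosen_cs \<theta> \<pi>1) \<pi>1"
    using cs_in_P(2) chosen_cs(2) sat_partitionD[OF p(1)] by blast
  show ?thesis
    using Delta_mor_indep[OF sat_partitionD[OF p(1)] sat_partitionD[OF p(2)] e a c]
      Delta_formula[OF sat_partitionD(1)[OF p(1)] sat_partitionD(1)[OF p(2)] e a c y]
    by simp
qed

section \<open>Functoriality of \<open>Gamma\<close> and \<open>Delta\<close>\<close>

text \<open>Decodes objects as \<open>(A, bar \<pi>)\<close> and morphisms as
  \<open>(f, star \<pi>1 \<pi>2 \<eta>)\<close> once for both bifunctors;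
  \<open>star_identity\<close> and \<open>star_compose\<close> turn identities and composites into
  the same form.\<close>

lemma set_functor_productI:
  fixes F :: "('x set \<times> ('x \<Rightarrow> 'x) set, ('x \<Rightarrow> 'x) \<times> (('x \<Rightarrow> 'x) \<Rightarrow> ('x \<Rightarrow> 'x)), 'x \<Rightarrow> 'x) setfun"
  assumes mor: "\<And>A B \<pi>1 \<pi>2 f \<eta> s. A \<noteq> {} \<Longrightarrow> inj_on \<theta> A \<Longrightarrow> B \<noteq> {} \<Longrightarrow> inj_on \<theta> B \<Longrightarrow>
      sat_partition \<theta> \<pi>1 \<Longrightarrow> sat_partition \<theta> \<pi>2 \<Longrightarrow> f \<in> A \<rightarrow>\<^sub>E B \<Longrightarrow> \<eta> \<in> \<pi>2 \<rightarrow>\<^sub>E \<pi>1 \<Longrightarrow>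
      s \<in> on_obj F (A, bar \<pi>1) \<Longrightarrow>
      on_mor F (A, bar \<pi>1) (B, bar \<pi>2) (f, star \<pi>1 \<pi>2 \<eta>) s \<in> on_obj F (B, bar \<pi>2)"
    and ident: "\<And>A \<pi> s. A \<noteq> {} \<Longrightarrow> inj_on \<theta> A \<Longrightarrow> sat_partition \<theta> \<pi> \<Longrightarrow>
      s \<in> on_obj F (A, bar \<pi>) \<Longrightarrow>
      on_mor F (A, bar \<pi>) (A, bar \<pi>) (\<lambda>x\<in>A. x, star \<pi> \<pi> (\<lambda>P\<in>\<pi>. P)) s = s"
    and comp: "\<And>A B C \<pi>1 \<pi>2 \<pi>3 f g \<eta> \<eta>' s. A \<noteq> {} \<Longrightarrow> inj_on \<theta> A \<Longrightarrow> B \<noteq> {} \<Longrightarrow> inj_on \<theta> B \<Longrightarrow>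
      C \<noteq> {} \<Longrightarrow> inj_on \<theta> C \<Longrightarrow>
      sat_partition \<theta> \<pi>1 \<Longrightarrow> sat_partition \<theta> \<pi>2 \<Longrightarrow> sat_partition \<theta> \<pi>3 \<Longrightarrow>
      f \<in> A \<rightarrow>\<^sub>E B \<Longrightarrow> g \<in> B \<rightarrow>\<^sub>E C \<Longrightarrow> \<eta> \<in> \<pi>2 \<rightarrow>\<^sub>E \<pi>1 \<Longrightarrow> \<eta>' \<in> \<pi>3 \<rightarrow>\<^sub>E \<pi>2 \<Longrightarrow>
      s \<in> on_obj F (A, bar \<pi>1) \<Longrightarrow>
      on_mor F (A, bar \<pi>1) (C, bar \<pi>3) (compose A g f, star \<pi>1 \<pi>3 (compose \<pi>3 \<eta> \<eta>')) s
      = on_mor F (B, bar \<pi>2) (C, bar \<pi>3) (g, star \<pi>2 \<pi>3 \<eta>')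
          (on_mor F (A, bar \<pi>1) (B, bar \<pi>2) (f, star \<pi>1 \<pi>2 \<eta>) s)"
  shows "set_functor (prod_cat (P_cat \<theta>) (Pi_cat \<theta>)) F"
proof -
  let ?C = "prod_cat (P_cat \<theta>) (Pi_cat \<theta>)"
  have objE: "\<exists>A \<pi>. a = (A, bar \<pi>) \<and> A \<noteq> {} \<and> inj_on \<theta> A \<and> sat_partition \<theta> \<pi>" if "a \<in> Obj ?C" for a
    using that by (auto simp: prod_cat_def P_cat_obj elim!: Pi_cat_objE)
  have homE: "\<exists>f \<eta>. m = (f, star \<pi>1 \<pi>2 \<eta>) \<and> f \<in> A \<rightarrow>\<^sub>E B \<and> \<eta> \<in> \<pi>2 \<rightarrow>\<^sub>E \<pi>1"
    if "m \<in> Hom ?C (A, bar \<pi>1) (B, bar \<pi>2)" "sat_partition \<theta> \<pi>1" "sat_partition \<theta> \<pi>2"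
    for A B \<pi>1 \<pi>2 m
    using that by (auto simp: prod_cat_def P_cat_hom Pi_cat_hom)
  show ?thesis
    unfolding set_functor_def
  proof (intro conjI ballI)
    fix a b m assume o: "a \<in> Obj ?C" "b \<in> Obj ?C" and m: "m \<in> Hom ?C a b"
    obtain A \<pi>1 where A: "a = (A, bar \<pi>1)" "A \<noteq> {}" "inj_on \<theta> A" "sat_partition \<theta> \<pi>1"
      using objE[OF o(1)] by blast
    obtain B \<pi>2 where B: "b = (B, bar \<pi>2)" "B \<noteq> {}" "inj_on \<theta> B" "sat_partition \<theta> \<pi>2"
      using objE[OF o(2)] by blast
    obtain f \<eta> where f: "m = (f, star \<pi>1 \<pi>2 \<eta>)" "f \<in> A \<rightarrow>\<^sub>E B" "\<eta> \<in> \<pi>2 \<rightarrow>\<^sub>E \<pi>1"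
      using homE[OF m[unfolded A(1) B(1)] A(4) B(4)] by (elim exE conjE)
    show "on_mor F a b m \<in> on_obj F a \<rightarrow> on_obj F b"
      unfolding A(1) B(1) f(1) using mor[OF A(2,3) B(2,3) A(4) B(4) f(2,3)] by blast
  next
    fix a s assume o: "a \<in> Obj ?C" and s: "s \<in> on_obj F a"
    obtain A \<pi> where A: "a = (A, bar \<pi>)" "A \<noteq> {}" "inj_on \<theta> A" "sat_partition \<theta> \<pi>"
      using objE[OF o] by blast
    have "Id ?C a = (\<lambda>x\<in>A. x, star \<pi> \<pi> (\<lambda>P\<in>\<pi>. P))"
      using A star_identity[OF sat_partitionD(1)[OF A(4)]] by (simp add: prod_cat_def P_cat_def Pi_cat_def)
    then show "on_mor F a a (Id ?C a) s = s" using ident[OF A(2-4)] s A(1) by simp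
  next
    fix a b c m n s assume o: "a \<in> Obj ?C" "b \<in> Obj ?C" "c \<in> Obj ?C"
      and m: "m \<in> Hom ?C a b" and n: "n \<in> Hom ?C b c" and s: "s \<in> on_obj F a"
    obtain A \<pi>1 where A: "a = (A, bar \<pi>1)" "A \<noteq> {}" "inj_on \<theta> A" "sat_partition \<theta> \<pi>1"
      using objE[OF o(1)] by blast
    obtain B \<pi>2 where B: "b = (B, bar \<pi>2)" "B \<noteq> {}" "inj_on \<theta> B" "sat_partition \<theta> \<pi>2"
      using objE[OF o(2)] by blast
    obtain C \<pi>3 where C: "c = (C, bar \<pi>3)" "C \<noteq> {}" "inj_on \<theta> C" "sat_partition \<theta> \<pi>3"
      using objE[OF o(3)] by blast
    obtain f \<eta> where f: "m = (f, star \<pi>1 \<pi>2 \<eta>)" "f \<in> A \<rightarrow>\<^sub>E B" "\<eta> \<in> \<pi>2 \<rightarrow>\<^sub>E \<pi>1"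
      using homE[OF m[unfolded A(1) B(1)] A(4) B(4)] by (elim exE conjE)
    obtain g \<eta>' where g: "n = (g, star \<pi>2 \<pi>3 \<eta>')" "g \<in> B \<rightarrow>\<^sub>E C" "\<eta>' \<in> \<pi>3 \<rightarrow>\<^sub>E \<pi>2"
      using homE[OF n[unfolded B(1) C(1)] B(4) C(4)] by (elim exE conjE)
    have "Comp ?C a b c m n = (compose A g f, star \<pi>1 \<pi>3 (compose \<pi>3 \<eta> \<eta>'))"
      using star_compose[OF sat_partitionD(1)[OF A(4)] sat_partitionD(1)[OF B(4)]
          sat_partitionD(1)[OF C(4)] f(3) g(3)] A(1) B(1) C(1) f(1) g(1)
      by (simp add: prod_cat_def P_cat_def Pi_cat_def)
    then show "on_mor F a c (Comp ?C a b c m n) s = on_mor F b c n (on_mor F a b m s)"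
      using comp[OF A(2,3) B(2,3) C(2,3) A(4) B(4) C(4) f(2) g(2) f(3) g(3)] s A(1) B(1) C(1) f(1) g(1)
      by simp
  qed
qed

lemma Gamma_mor_mem:
  assumes p: "sat_partition \<theta> \<pi>1" "sat_partition \<theta> \<pi>2" and f: "f \<in> A \<rightarrow>\<^sub>E B"
    and e: "\<eta> \<in> \<pi>2 \<rightarrow>\<^sub>E \<pi>1" and a: "a \<in> on_obj (Gamma \<theta>) (A, bar \<pi>1)"
  shows "on_mor (Gamma \<theta>) (A, bar \<pi>1) (B, bar \<pi>2) (f, star \<pi>1 \<pi>2 \<eta>) a \<in> on_obj (Gamma \<theta>) (B, bar \<pi>2)"
    (is "?b \<in> _")
proof -
  note q = sat_partitionD(1)[OF p(2)]
  have ex: "\<exists>y. \<theta> y \<in> \<eta> (class_of \<pi>2 x)" for x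
    using e class_of_in(1)[OF q, of x] sat_obtain[OF p(1)] by (metis PiE_mem)
  have ran: "range a \<subseteq> A" using a unfolding Gamma_obj[OF p(1)] by blast
  show ?thesis unfolding Gamma_obj[OF p(2)]
  proof (intro conjI ballI allI impI)
    show "range ?b \<subseteq> B"
    proof clarify
      fix x
      obtain y where y: "\<theta> y \<in> \<eta> (class_of \<pi>2 (\<theta> x))" using ex by blast
      have "f (a y) \<in> B" for y using f ran by auto
      then show "?b x \<in> B" by (simp only: Gamma_mor[OF p e a y])
    qed
    fix P x x' assume P: "P \<in> \<pi>2" "\<theta> x \<in> P" "\<theta> x' \<in> P"
    \<comment> \<open>The new value at a point depends only on the \<open>\<pi>2\<close>-class of
      its image under \<open>\<theta>\<close>, so one \<open>y\<close> serves both points.\<close>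
    have c: "class_of \<pi>2 (\<theta> x) = class_of \<pi>2 (\<theta> x')" using class_of_eq[OF q] P by metis
    obtain y where y: "\<theta> y \<in> \<eta> (class_of \<pi>2 (\<theta> x))" using ex by blast
    show "?b x = ?b x'" using Gamma_mor[OF p e a y] Gamma_mor[OF p e a, of y x'] y c by simp
  qed
qed

lemma Delta_mor_mem:
  assumes p: "sat_partition \<theta> \<pi>1" "sat_partition \<theta> \<pi>2" and f: "f \<in> A \<rightarrow>\<^sub>E B"
    and e: "\<eta> \<in> \<pi>2 \<rightarrow>\<^sub>E \<pi>1" and a: "a \<in> on_obj (Delta \<theta>) (A, bar \<pi>1)"
  shows "on_mor (Delta \<theta>) (A, bar \<pi>1) (B, bar \<pi>2) (f, star \<pi>1 \<pi>2 \<eta>) a \<in> on_obj (Delta \<theta>) (B, bar \<pi>2)"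
    (is "?b \<in> _")
proof -
  note q = sat_partitionD(1)[OF p(2)]
  have ex: "\<exists>y. y \<in> \<eta> (class_of \<pi>2 x)" for x
    using e class_of_in(1)[OF q, of x] class_nonempty[OF sat_partitionD(1)[OF p(1)]] by (metis PiE_mem)
  have ran: "range a \<subseteq> \<theta> ` A" using a unfolding Delta_obj by blast
  show ?thesis unfolding Delta_obj
  proof
    show "range ?b \<subseteq> \<theta> ` B"
    proof clarify
      fix x
      obtain y where y: "y \<in> \<eta> (class_of \<pi>2 x)" using ex by blast
      \<comment> \<open>Values of \<open>a\<close> lie in the image of \<open>A\<close>, so they can
        be pulled back into \<open>A\<close> before \<open>f\<close> is applied.\<close>
      have "inv_into A \<theta> (a y) \<in> A" using ran by (intro inv_into_into) blast
      then show "?b x \<in> \<theta> ` B" using Delta_mor[OF p e a y] f by auto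
    qed
    show "?b \<in> bar \<pi>2"
    proof (rule barI_class[OF q])
      fix x x' assume c: "class_of \<pi>2 x = class_of \<pi>2 x'"
      obtain y where y: "y \<in> \<eta> (class_of \<pi>2 x)" using ex by blast
      show "?b x = ?b x'" using Delta_mor[OF p e a y] Delta_mor[OF p e a, of y x'] y c by simp
    qed
  qed
qed

lemma set_functor_Gamma: "set_functor (prod_cat (P_cat \<theta>) (Pi_cat \<theta>)) (Gamma \<theta>)"
proof (rule set_functor_productI, goal_cases)
  case (1 A B \<pi>1 \<pi>2 f \<eta> s)
  then show ?case by (intro Gamma_mor_mem)
next
  case (2 A \<pi> s)
  note p = sat_partitionD(1)[OF \<open>sat_partition \<theta> \<pi>\<close>]
  show ?case
  proof
    fix x
    have "s x \<in> A" using 2 unfolding Gamma_obj[OF \<open>sat_partition \<theta> \<pi>\<close>] by blast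
    \<comment> \<open>Here \<open>x\<close> itself is the representative, since
      \<open>\<theta> x\<close> lies in its own class; \<open>s x \<in> A\<close> keeps the
      restricted identity away from its default value.\<close>
    then show "on_mor (Gamma \<theta>) (A, bar \<pi>) (A, bar \<pi>) (\<lambda>x\<in>A. x, star \<pi> \<pi> (\<lambda>P\<in>\<pi>. P)) s x = s x"
      using Gamma_mor[OF 2(3,3) _ 2(4), of "\<lambda>P\<in>\<pi>. P" x x] class_of_in[OF p] by simp
  qed
next
  case (3 A B C \<pi>1 \<pi>2 \<pi>3 f g \<eta> \<eta>' s)
  note s = \<open>s \<in> on_obj (Gamma \<theta>) (A, bar \<pi>1)\<close>
  let ?t = "on_mor (Gamma \<theta>) (A, bar \<pi>1) (B, bar \<pi>2) (f, star \<pi>1 \<pi>2 \<eta>) s"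
  have t: "?t \<in> on_obj (Gamma \<theta>) (B, bar \<pi>2)" using 3 by (intro Gamma_mor_mem)
  show ?case
  proof
    fix x
    \<comment> \<open>Representatives are followed through the classes: \<open>y\<close> for the one
      chosen by \<open>\<eta>'\<close>, then \<open>z\<close> for the one \<open>\<eta>\<close>
      assigns to it. Both sides then equal \<open>g (f (s z))\<close>.\<close>
    have c3: "class_of \<pi>3 (\<theta> x) \<in> \<pi>3" using class_of_in(1)[OF sat_partitionD(1)[OF 3(9)]] .
    then have c2: "\<eta>' (class_of \<pi>3 (\<theta> x)) \<in> \<pi>2" using 3 by auto
    then obtain y where y: "\<theta> y \<in> \<eta>' (class_of \<pi>3 (\<theta> x))" using sat_obtain[OF 3(8)] by blast
    have cy: "class_of \<pi>2 (\<theta> y) = \<eta>' (class_of \<pi>3 (\<theta> x))"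
      using class_of_eq[OF sat_partitionD(1)[OF 3(8)] c2 y] .
    then have "\<eta> (class_of \<pi>2 (\<theta> y)) \<in> \<pi>1" using c2 3 by auto
    then obtain z where z: "\<theta> z \<in> \<eta> (class_of \<pi>2 (\<theta> y))" using sat_obtain[OF 3(7)] by blast
    have "s z \<in> A" using s unfolding Gamma_obj[OF 3(7)] by blast
    moreover have "compose \<pi>3 \<eta> \<eta>' \<in> \<pi>3 \<rightarrow>\<^sub>E \<pi>1" using 3 by (auto simp: compose_def)
    ultimately show "on_mor (Gamma \<theta>) (A, bar \<pi>1) (C, bar \<pi>3)
          (compose A g f, star \<pi>1 \<pi>3 (compose \<pi>3 \<eta> \<eta>')) s x
        = on_mor (Gamma \<theta>) (B, bar \<pi>2) (C, bar \<pi>3) (g, star \<pi>2 \<pi>3 \<eta>') ?t x"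
      using Gamma_mor[OF 3(8,9,13) t y] Gamma_mor[OF 3(7,8,12) s z]
        Gamma_mor[OF 3(7,9) _ s, of "compose \<pi>3 \<eta> \<eta>'" z x] z cy c3
      by (simp add: compose_eq)
  qed
qed

lemma set_functor_Delta: "set_functor (prod_cat (P_cat \<theta>) (Pi_cat \<theta>)) (Delta \<theta>)"
proof (rule set_functor_productI, goal_cases)
  case (1 A B \<pi>1 \<pi>2 f \<eta> s)
  then show ?case by (intro Delta_mor_mem)
next
  case (2 A \<pi> s)
  note p = sat_partitionD(1)[OF \<open>sat_partition \<theta> \<pi>\<close>]
  show ?case
  proof
    fix x
    have "s x \<in> \<theta> ` A" using 2 unfolding Delta_obj by blast
    then show "on_mor (Delta \<theta>) (A, bar \<pi>) (A, bar \<pi>) (\<lambda>x\<in>A. x, star \<pi> \<pi> (\<lambda>P\<in>\<pi>. P)) s x = s x"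
      using Delta_mor[OF 2(3,3) _ 2(4), of "\<lambda>P\<in>\<pi>. P" x x] class_of_in[OF p]
      by (simp add: inv_into_into f_inv_into_f)
  qed
next
  case (3 A B C \<pi>1 \<pi>2 \<pi>3 f g \<eta> \<eta>' s)
  note s = \<open>s \<in> on_obj (Delta \<theta>) (A, bar \<pi>1)\<close>
  let ?t = "on_mor (Delta \<theta>) (A, bar \<pi>1) (B, bar \<pi>2) (f, star \<pi>1 \<pi>2 \<eta>) s"
  have t: "?t \<in> on_obj (Delta \<theta>) (B, bar \<pi>2)" using 3 by (intro Delta_mor_mem)
  show ?case
  proof
    fix x
    have c3: "class_of \<pi>3 x \<in> \<pi>3" using class_of_in(1)[OF sat_partitionD(1)[OF 3(9)]] .
    then have c2: "\<eta>' (class_of \<pi>3 x) \<in> \<pi>2" using 3 by auto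
    then obtain y where y: "y \<in> \<eta>' (class_of \<pi>3 x)"
      using class_nonempty[OF sat_partitionD(1)[OF 3(8)]] by blast
    have cy: "class_of \<pi>2 y = \<eta>' (class_of \<pi>3 x)"
      using class_of_eq[OF sat_partitionD(1)[OF 3(8)] c2 y] .
    then have "\<eta> (class_of \<pi>2 y) \<in> \<pi>1" using c2 3 by auto
    then obtain z where z: "z \<in> \<eta> (class_of \<pi>2 y)"
      using class_nonempty[OF sat_partitionD(1)[OF 3(7)]] by blast
    have i: "inv_into A \<theta> (s z) \<in> A" using s unfolding Delta_obj by (intro inv_into_into) blast
    \<comment> \<open>The first morphism ends with \<open>\<theta>\<close> and the second begins by
      inverting \<open>\<theta>\<close> on \<open>B\<close>; the two cancel because the intermediate
      value lies in \<open>B\<close>, where \<open>\<theta>\<close> is injective.\<close>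
    then have "f (inv_into A \<theta> (s z)) \<in> B" using 3 by auto
    then have "inv_into B \<theta> (\<theta> (f (inv_into A \<theta> (s z)))) = f (inv_into A \<theta> (s z))"
      by (rule inv_into_f_f[OF 3(4)])
    moreover have "compose \<pi>3 \<eta> \<eta>' \<in> \<pi>3 \<rightarrow>\<^sub>E \<pi>1" using 3 by (auto simp: compose_def)
    ultimately show "on_mor (Delta \<theta>) (A, bar \<pi>1) (C, bar \<pi>3)
          (compose A g f, star \<pi>1 \<pi>3 (compose \<pi>3 \<eta> \<eta>')) s x
        = on_mor (Delta \<theta>) (B, bar \<pi>2) (C, bar \<pi>3) (g, star \<pi>2 \<pi>3 \<eta>') ?t x"
      using Delta_mor[OF 3(8,9,13) t y] Delta_mor[OF 3(7,8,12) s z]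
        Delta_mor[OF 3(7,9) _ s, of "compose \<pi>3 \<eta> \<eta>'" z x] z cy c3 i
      by (simp add: compose_eq)
  qed
qed

section \<open>The forms \<open>\<theta> \<Zcomp> a\<close> and \<open>a \<Zcomp> \<theta>\<close>
  with \<open>a\<close> regular\<close>

text \<open>Regularity comes for free: injectivity of \<open>\<theta>\<close> on \<open>A\<close>
  recovers \<open>a x\<close> from \<open>\<theta> (a x)\<close>, and saturation provides a point of
  the image of \<open>\<theta>\<close> in the class of \<open>x\<close>, at which \<open>a\<close>
  takes that value again. An inverse \<open>b\<close> sends \<open>\<theta> (a x)\<close> to a
  preimage of such a point.\<close>

lemma Reg_at_bar:
  assumes p: "sat_partition \<theta> \<pi>" and inj: "inj_on \<theta> A"
  shows "a \<in> Reg_at \<theta> A (bar \<pi>) \<longleftrightarrow> range a \<subseteq> A \<and> a \<in> bar \<pi>"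
proof -
  have "a \<in> Reg \<theta>" if r: "range a \<subseteq> A" and b: "a \<in> bar \<pi>"
  proof -
    \<comment> \<open>One \<open>y\<close> must work for every \<open>x\<close> over the same
      \<open>z\<close>, so that \<open>b\<close> can be chosen as a function of \<open>z\<close>
      alone.\<close>
    have "\<exists>y. \<forall>x. \<theta> (a x) = z \<longrightarrow> a (\<theta> y) = a x" for z
    proof (cases "\<exists>x0. \<theta> (a x0) = z")
      case True
      then obtain x0 where x0: "\<theta> (a x0) = z" by blast
      note c = class_of_in[OF sat_partitionD(1)[OF p], of x0]
      obtain y where "\<theta> y \<in> class_of \<pi> x0" using sat_obtain[OF p c(1)] .
      then have "a (\<theta> y) = a x0" using bar_eqD[OF b c(1)] c(2) by blast
      moreover have "a x = a x0" if "\<theta> (a x) = z" for x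
        using inj_onD[OF inj, of "a x" "a x0"] that x0 r by auto
      ultimately show ?thesis by metis
    qed blast
    then obtain b where "\<And>z x. \<theta> (a x) = z \<Longrightarrow> a (\<theta> (b z)) = a x" by metis
    then have "variant_mult \<theta> (variant_mult \<theta> a b) a = a"
      by (simp add: variant_mult_def rcomp_def fun_eq_iff)
    then show ?thesis unfolding Reg_def by blast
  qed
  then show ?thesis by (auto simp: Reg_at_def bar_fibres_subset)
qed

lemma Gamma_obj_eq_image:
  assumes p: "sat_partition \<theta> \<pi>" and inj: "inj_on \<theta> A"
  shows "on_obj (Gamma \<theta>) (A, bar \<pi>) = (\<lambda>a. \<theta> \<Zcomp> a) ` Reg_at \<theta> A (bar \<pi>)"
proof (intro equalityI subsetI)
  fix g assume g: "g \<in> on_obj (Gamma \<theta>) (A, bar \<pi>)"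
  note q = sat_partitionD(1)[OF p]
  have "\<exists>y. \<theta> y \<in> class_of \<pi> x" for x using sat_obtain[OF p class_of_in(1)[OF q]] by metis
  then have s: "\<theta> (SOME y. \<theta> y \<in> class_of \<pi> x) \<in> class_of \<pi> x" for x by (rule someI_ex)
  \<comment> \<open>Forced choice: \<open>a\<close> at \<open>x\<close> is the common value of
    \<open>g\<close> on the preimage of the class of \<open>x\<close>, nonempty by saturation. It
    depends on the class only.\<close>
  define a where "a = (\<lambda>x. g (SOME y. \<theta> y \<in> class_of \<pi> x))"
  have "range g \<subseteq> A" using g unfolding Gamma_obj[OF p] by blast
  then have "range a \<subseteq> A" by (auto simp: a_def)
  moreover have "a \<in> bar \<pi>" by (rule barI_class[OF q]) (simp add: a_def)
  moreover have "g = \<theta> \<Zcomp> a"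
  proof
    fix x
    show "g x = (\<theta> \<Zcomp> a) x"
      using Gamma_objD[OF p g class_of_in(1)[OF q, of "\<theta> x"] class_of_in(2)[OF q] s[of "\<theta> x"]]
      by (simp add: rcomp_def a_def)
  qed
  ultimately show "g \<in> (\<lambda>a. \<theta> \<Zcomp> a) ` Reg_at \<theta> A (bar \<pi>)" using Reg_at_bar[OF p inj] by blast
next
  fix g assume "g \<in> (\<lambda>a. \<theta> \<Zcomp> a) ` Reg_at \<theta> A (bar \<pi>)"
  then obtain a where a: "g = \<theta> \<Zcomp> a" "range a \<subseteq> A" "a \<in> bar \<pi>" using Reg_at_bar[OF p inj] by auto
  then show "g \<in> on_obj (Gamma \<theta>) (A, bar \<pi>)"
    unfolding Gamma_obj[OF p] rcomp_def by (blast intro: bar_eqD)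
qed

lemma Delta_obj_eq_image:
  assumes p: "sat_partition \<theta> \<pi>" and inj: "inj_on \<theta> A"
  shows "on_obj (Delta \<theta>) (A, bar \<pi>) = (\<lambda>a. a \<Zcomp> \<theta>) ` Reg_at \<theta> A (bar \<pi>)"
proof (intro equalityI subsetI)
  fix b assume b: "b \<in> on_obj (Delta \<theta>) (A, bar \<pi>)"
  \<comment> \<open>The factor \<open>\<theta>\<close> on the right is removed by its inverse on
    \<open>A\<close>.\<close>
  define a where "a = b \<Zcomp> inv_into A \<theta>"
  have r: "b x \<in> \<theta> ` A" for x using b unfolding Delta_obj by blast
  have "range a \<subseteq> A" using inv_into_into[OF r] by (auto simp: a_def rcomp_def)
  moreover have "a \<in> bar \<pi>" using b rcomp_mem_bar unfolding Delta_obj a_def by blast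
  moreover have "b = a \<Zcomp> \<theta>" using f_inv_into_f[OF r] by (simp add: a_def rcomp_def fun_eq_iff)
  ultimately show "b \<in> (\<lambda>a. a \<Zcomp> \<theta>) ` Reg_at \<theta> A (bar \<pi>)" using Reg_at_bar[OF p inj] by blast
next
  fix b assume "b \<in> (\<lambda>a. a \<Zcomp> \<theta>) ` Reg_at \<theta> A (bar \<pi>)"
  then obtain a where a: "b = a \<Zcomp> \<theta>" "range a \<subseteq> A" "a \<in> bar \<pi>" using Reg_at_bar[OF p inj] by auto
  then show "b \<in> on_obj (Delta \<theta>) (A, bar \<pi>)"
    unfolding Delta_obj using rcomp_mem_bar[of a \<pi> \<theta>] by (auto simp: rcomp_def)
qed

section \<open>Existence of the duality\<close>

text \<open>A component must act on \<open>g\<close> itself, not on a factorisation of it. If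
  \<open>g\<close> is \<open>\<theta> \<Zcomp> a\<close> with \<open>a\<close> constant on classes,
  then \<open>g\<close> at the selected preimage is \<open>a x\<close>, so the outcome is
  \<open>\<theta> (a x)\<close>.\<close>

definition transfer :: "('x \<Rightarrow> 'x) \<Rightarrow> 'x set \<times> ('x \<Rightarrow> 'x) set \<Rightarrow> ('x \<Rightarrow> 'x) \<Rightarrow> ('x \<Rightarrow> 'x)"
  where "transfer \<theta> = (\<lambda>(A, Q) g x. \<theta> (g (SOME y. \<theta> y \<in> class_of (part_of Q) x)))"

lemma transfer_apply:
  assumes p: "sat_partition \<theta> \<pi>" and inj: "inj_on \<theta> A" and a: "a \<in> Reg_at \<theta> A (bar \<pi>)"
  shows "transfer \<theta> (A, bar \<pi>) (\<theta> \<Zcomp> a) = a \<Zcomp> \<theta>"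
proof
  fix x
  note q = sat_partitionD(1)[OF p]
  have "\<exists>y. \<theta> y \<in> class_of \<pi> x" using sat_obtain[OF p class_of_in(1)[OF q]] by metis
  then have "\<theta> (SOME y. \<theta> y \<in> class_of \<pi> x) \<in> class_of \<pi> x" by (rule someI_ex)
  then have "a (\<theta> (SOME y. \<theta> y \<in> class_of \<pi> x)) = a x"
    using a bar_eqD[OF _ class_of_in[OF q]] unfolding Reg_at_bar[OF p inj] by metis
  then show "transfer \<theta> (A, bar \<pi>) (\<theta> \<Zcomp> a) x = (a \<Zcomp> \<theta>) x"
    by (simp add: transfer_def part_of_bar[OF q] rcomp_def)
qed

text \<open>Both sets are images of \<open>Reg_at \<theta> A (bar \<pi>)\<close>, and
  \<open>\<theta>\<close> can be cancelled on the right of its elements because it is injective on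
  \<open>A\<close>.\<close>

lemma transfer_bij:
  assumes p: "sat_partition \<theta> \<pi>" and inj: "inj_on \<theta> A"
  shows "bij_betw (transfer \<theta> (A, bar \<pi>)) (on_obj (Gamma \<theta>) (A, bar \<pi>)) (on_obj (Delta \<theta>) (A, bar \<pi>))"
proof -
  have "inj_on (transfer \<theta> (A, bar \<pi>)) (on_obj (Gamma \<theta>) (A, bar \<pi>))"
  proof (rule inj_onI)
    fix g g' assume g: "g \<in> on_obj (Gamma \<theta>) (A, bar \<pi>)" "g' \<in> on_obj (Gamma \<theta>) (A, bar \<pi>)"
      and eq: "transfer \<theta> (A, bar \<pi>) g = transfer \<theta> (A, bar \<pi>) g'"
    obtain a where a: "g = \<theta> \<Zcomp> a" "a \<in> Reg_at \<theta> A (bar \<pi>)"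
      using g(1) unfolding Gamma_obj_eq_image[OF p inj] by (rule imageE)
    obtain a' where a': "g' = \<theta> \<Zcomp> a'" "a' \<in> Reg_at \<theta> A (bar \<pi>)"
      using g(2) unfolding Gamma_obj_eq_image[OF p inj] by (rule imageE)
    have "a \<Zcomp> \<theta> = a' \<Zcomp> \<theta>"
      using eq unfolding a(1) a'(1) transfer_apply[OF p inj a(2)] transfer_apply[OF p inj a'(2)] .
    then have eq': "\<theta> (a x) = \<theta> (a' x)" for x unfolding rcomp_def by (rule fun_cong)
    have "a x \<in> A" "a' x \<in> A" for x
      using a(2) a'(2) by (auto simp: Reg_at_bar[OF p inj])
    then have "a = a'" by (intro ext inj_onD[OF inj eq'])
    then show "g = g'" using a(1) a'(1) by simp
  qed
  moreover have "transfer \<theta> (A, bar \<pi>) ` on_obj (Gamma \<theta>) (A, bar \<pi>) = on_obj (Delta \<theta>) (A, bar \<pi>)"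
    unfolding Gamma_obj_eq_image[OF p inj] Delta_obj_eq_image[OF p inj] image_image
    by (rule image_cong[OF refl transfer_apply[OF p inj]])
  ultimately show ?thesis by (rule bij_betw_imageI)
qed

text \<open>Write \<open>s\<close> as \<open>\<theta> \<Zcomp> a\<close> and its image under
  \<open>Gamma\<close> as \<open>\<theta> \<Zcomp> b\<close>. Pointwise, \<open>b x\<close> is
  \<open>f (a (\<theta> y))\<close> for a suitable \<open>y\<close>, and the \<open>Delta\<close>
  side gives \<open>\<theta>\<close> of the same value once the inverse of \<open>\<theta>\<close>
  on \<open>A\<close> is cancelled.\<close>

lemma transfer_natural:
  assumes p: "sat_partition \<theta> \<pi>1" "sat_partition \<theta> \<pi>2" and inj: "inj_on \<theta> A" "inj_on \<theta> B"
    and f: "f \<in> A \<rightarrow>\<^sub>E B" and e: "\<eta> \<in> \<pi>2 \<rightarrow>\<^sub>E \<pi>1" and s: "s \<in> on_obj (Gamma \<theta>) (A, bar \<pi>1)"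
  shows "transfer \<theta> (B, bar \<pi>2) (on_mor (Gamma \<theta>) (A, bar \<pi>1) (B, bar \<pi>2) (f, star \<pi>1 \<pi>2 \<eta>) s)
    = on_mor (Delta \<theta>) (A, bar \<pi>1) (B, bar \<pi>2) (f, star \<pi>1 \<pi>2 \<eta>) (transfer \<theta> (A, bar \<pi>1) s)"
proof -
  obtain a where a: "s = \<theta> \<Zcomp> a" "a \<in> Reg_at \<theta> A (bar \<pi>1)"
    using s unfolding Gamma_obj_eq_image[OF p(1) inj(1)] by blast
  have ra: "range a \<subseteq> A" using a unfolding Reg_at_bar[OF p(1) inj(1)] by blast
  obtain b where b: "on_mor (Gamma \<theta>) (A, bar \<pi>1) (B, bar \<pi>2) (f, star \<pi>1 \<pi>2 \<eta>) s = \<theta> \<Zcomp> b"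
    "b \<in> Reg_at \<theta> B (bar \<pi>2)"
    using Gamma_mor_mem[OF p f e s] unfolding Gamma_obj_eq_image[OF p(2) inj(2)] by blast
  have d: "a \<Zcomp> \<theta> \<in> on_obj (Delta \<theta>) (A, bar \<pi>1)"
    using a unfolding Delta_obj_eq_image[OF p(1) inj(1)] by blast
  have "b \<Zcomp> \<theta> = on_mor (Delta \<theta>) (A, bar \<pi>1) (B, bar \<pi>2) (f, star \<pi>1 \<pi>2 \<eta>) (a \<Zcomp> \<theta>)"
  proof
    fix x
    note c = class_of_in[OF sat_partitionD(1)[OF p(2)], of x]
    \<comment> \<open>Knowing \<open>\<theta> \<Zcomp> b\<close> reveals \<open>b\<close> only on
      the image of \<open>\<theta>\<close>, so \<open>x\<close> is replaced by a point
      \<open>\<theta> z\<close> of its class.\<close>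
    obtain z where z: "\<theta> z \<in> class_of \<pi>2 x" using sat_obtain[OF p(2) c(1)] .
    have cz: "class_of \<pi>2 (\<theta> z) = class_of \<pi>2 x"
      using class_of_eq[OF sat_partitionD(1)[OF p(2)] c(1) z] .
    have "\<eta> (class_of \<pi>2 x) \<in> \<pi>1" using c e by blast
    then obtain y where y: "\<theta> y \<in> \<eta> (class_of \<pi>2 x)" using sat_obtain[OF p(1)] by blast
    have "b x = b (\<theta> z)" using b(2) bar_eqD[OF _ c z] unfolding Reg_at_bar[OF p(2) inj(2)] by blast
    also have "\<dots> = f (a (\<theta> y))"
      using fun_cong[OF b(1), of z] Gamma_mor[OF p e s, of y z] y cz a(1) by (simp add: rcomp_def)
    finally have "b x = f (a (\<theta> y))" .
    moreover have "inv_into A \<theta> (\<theta> (a (\<theta> y))) = a (\<theta> y)"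
      using ra by (intro inv_into_f_f[OF inj(1)]) blast
    ultimately show "(b \<Zcomp> \<theta>) x
        = on_mor (Delta \<theta>) (A, bar \<pi>1) (B, bar \<pi>2) (f, star \<pi>1 \<pi>2 \<eta>) (a \<Zcomp> \<theta>) x"
      using Delta_mor[OF p e d y] by (simp add: rcomp_def)
  qed
  then show ?thesis
    using transfer_apply[OF p(1) inj(1) a(2)] transfer_apply[OF p(2) inj(2) b(2)] a(1) b(1) by simp
qed

lemma duality_transfer: "duality \<theta> (transfer \<theta>)"
  unfolding duality_def natural_iso_def
proof (intro conjI ballI)
  let ?C = "prod_cat (P_cat \<theta>) (Pi_cat \<theta>)"
  show "category ?C" by (intro category_prod_cat category_P_cat category_Pi_cat)
  show "set_functor ?C (Gamma \<theta>)" "set_functor ?C (Delta \<theta>)"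
    by (rule set_functor_Gamma set_functor_Delta)+
  show "bij_betw (transfer \<theta> a) (on_obj (Gamma \<theta>) a) (on_obj (Delta \<theta>) a)" if "a \<in> Obj ?C" for a
    using that by (auto simp: prod_cat_def P_cat_obj elim!: Pi_cat_objE intro: transfer_bij)
  show "transfer \<theta> b (on_mor (Gamma \<theta>) a b m s) = on_mor (Delta \<theta>) a b m (transfer \<theta> a s)"
    if "a \<in> Obj ?C" "b \<in> Obj ?C" "m \<in> Hom ?C a b" "s \<in> on_obj (Gamma \<theta>) a" for a b m s
    using that
    by (auto simp: prod_cat_def P_cat_obj P_cat_hom Pi_cat_hom elim!: Pi_cat_objE intro!: transfer_natural)
qed

section \<open>Uniqueness of the duality\<close>

lemma sat_partition_one_class: "sat_partition \<theta> {UNIV}"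
  by (auto simp: sat_partition_def partition_on_def disjoint_def saturates_def)

lemma duality_bij:
  assumes "duality \<theta> \<chi>" "A \<noteq> {}" "inj_on \<theta> A" "sat_partition \<theta> \<pi>"
  shows "bij_betw (\<chi> (A, bar \<pi>)) (on_obj (Gamma \<theta>) (A, bar \<pi>)) (on_obj (Delta \<theta>) (A, bar \<pi>))"
proof -
  have "(A, bar \<pi>) \<in> Obj (prod_cat (P_cat \<theta>) (Pi_cat \<theta>))"
    using assms by (simp add: prod_cat_def P_cat_obj Pi_cat_objI)
  then show ?thesis using assms(1) unfolding duality_def natural_iso_def by blast
qed

lemma duality_natural:
  assumes d: "duality \<theta> \<chi>" and A: "A \<noteq> {}" "inj_on \<theta> A" and B: "B \<noteq> {}" "inj_on \<theta> B"
    and p: "sat_partition \<theta> \<pi>1" "sat_partition \<theta> \<pi>2"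
    and f: "f \<in> A \<rightarrow>\<^sub>E B" and e: "\<eta> \<in> \<pi>2 \<rightarrow>\<^sub>E \<pi>1" and s: "s \<in> on_obj (Gamma \<theta>) (A, bar \<pi>1)"
  shows "\<chi> (B, bar \<pi>2) (on_mor (Gamma \<theta>) (A, bar \<pi>1) (B, bar \<pi>2) (f, star \<pi>1 \<pi>2 \<eta>) s)
    = on_mor (Delta \<theta>) (A, bar \<pi>1) (B, bar \<pi>2) (f, star \<pi>1 \<pi>2 \<eta>) (\<chi> (A, bar \<pi>1) s)"
proof -
  let ?C = "prod_cat (P_cat \<theta>) (Pi_cat \<theta>)"
  have o: "(A, bar \<pi>1) \<in> Obj ?C" "(B, bar \<pi>2) \<in> Obj ?C"
    using A B p by (simp_all add: prod_cat_def P_cat_obj Pi_cat_objI)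
  have m: "(f, star \<pi>1 \<pi>2 \<eta>) \<in> Hom ?C (A, bar \<pi>1) (B, bar \<pi>2)"
    using f e p by (simp add: prod_cat_def P_cat_hom Pi_cat_hom)
  show ?thesis using d o m s unfolding duality_def natural_iso_def by blast
qed

lemma duality_const:
  assumes d: "duality \<theta> \<chi>" and A: "inj_on \<theta> A" "p \<in> A"
  shows "\<chi> (A, bar {UNIV}) (\<lambda>_. p) = (\<lambda>_. \<theta> p)"
proof -
  note u = sat_partition_one_class[of \<theta>]
  have s: "(\<lambda>_. p) \<in> on_obj (Gamma \<theta>) ({p}, bar {UNIV})" unfolding Gamma_obj[OF u] by auto
  then have "\<chi> ({p}, bar {UNIV}) (\<lambda>_. p) \<in> on_obj (Delta \<theta>) ({p}, bar {UNIV})"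
    using duality_bij[OF d _ _ u, of "{p}"] by (auto dest: bij_betw_apply)
  then have c: "\<chi> ({p}, bar {UNIV}) (\<lambda>_. p) = (\<lambda>_. \<theta> p)"
    and m: "(\<lambda>_. \<theta> p) \<in> on_obj (Delta \<theta>) ({p}, bar {UNIV})"
    unfolding Delta_obj by (auto simp: fun_eq_iff bar_def)
  \<comment> \<open>The inclusion of \<open>{p}\<close> into \<open>A\<close>, paired with the only
    self-map \<open>\<eta>\<close> of the one-class partition, so that both bifunctors carry the
    constant map to itself.\<close>
  let ?f = "\<lambda>x\<in>{p}. x"
  define \<eta> where "\<eta> = (\<lambda>P\<in>{UNIV::'a set}. UNIV::'a set)"
  have e: "\<eta> \<in> {UNIV} \<rightarrow>\<^sub>E {UNIV}" by (auto simp: \<eta>_def)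
  have k: "x \<in> \<eta> (class_of {UNIV} y)" for x y :: 'a
    using class_of_in(1)[OF sat_partitionD(1)[OF u], of y] by (simp add: \<eta>_def)
  have "on_mor (Gamma \<theta>) ({p}, bar {UNIV}) (A, bar {UNIV}) (?f, star {UNIV} {UNIV} \<eta>) (\<lambda>_. p) = (\<lambda>_. p)"
    using Gamma_mor[OF u u e s k] by (intro ext) simp
  moreover have "on_mor (Delta \<theta>) ({p}, bar {UNIV}) (A, bar {UNIV}) (?f, star {UNIV} {UNIV} \<eta>) (\<lambda>_. \<theta> p)
      = (\<lambda>_. \<theta> p)"
    using Delta_mor[OF u u e m k] inv_into_f_f[of \<theta> "{p}" p] by (intro ext) simp
  moreover have "?f \<in> {p} \<rightarrow>\<^sub>E A" using A by auto
  ultimately show ?thesis using duality_natural[OF d _ _ _ A(1) u u _ e s, of ?f] A c by auto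
qed

lemma duality_apply:
  assumes d: "duality \<theta> \<chi>" and A: "A \<noteq> {}" "inj_on \<theta> A" and p: "sat_partition \<theta> \<pi>"
    and a: "a \<in> Reg_at \<theta> A (bar \<pi>)"
  shows "\<chi> (A, bar \<pi>) (\<theta> \<Zcomp> a) = a \<Zcomp> \<theta>"
proof
  fix x
  note u = sat_partition_one_class[of \<theta>]
  note c = class_of_in[OF sat_partitionD(1)[OF p], of x]
  have s: "\<theta> \<Zcomp> a \<in> on_obj (Gamma \<theta>) (A, bar \<pi>)" using a Gamma_obj_eq_image[OF p A(2)] by blast
  have t: "\<chi> (A, bar \<pi>) (\<theta> \<Zcomp> a) \<in> on_obj (Delta \<theta>) (A, bar \<pi>)"
    using duality_bij[OF d A p] s by (rule bij_betw_apply)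
  have ab: "range a \<subseteq> A" "a \<in> bar \<pi>" using a Reg_at_bar[OF p A(2)] by blast+
  let ?f = "\<lambda>x\<in>A. x"
  \<comment> \<open>The induced morphism from \<open>bar \<pi>\<close> to \<open>bar {UNIV}\<close>
    evaluates maps at the class of \<open>x\<close>, turning them into constants.\<close>
  define \<eta> where "\<eta> = (\<lambda>P\<in>{UNIV::'a set}. class_of \<pi> x)"
  have e: "\<eta> \<in> {UNIV} \<rightarrow>\<^sub>E \<pi>" and f: "?f \<in> A \<rightarrow>\<^sub>E A" using c by (auto simp: \<eta>_def)
  have k: "\<eta> (class_of {UNIV} y) = class_of \<pi> x" for y
    using class_of_in(1)[OF sat_partitionD(1)[OF u], of y] by (simp add: \<eta>_def)
  obtain z where z: "\<theta> z \<in> class_of \<pi> x" using sat_obtain[OF p c(1)] .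
  have ax: "a (\<theta> z) = a x" using bar_eqD[OF ab(2) c(1) z c(2)] .
  \<comment> \<open>On the \<open>Gamma\<close> side this evaluation goes through the preimage
    \<open>z\<close>, where \<open>\<theta> \<Zcomp> a\<close> takes the value
    \<open>a (\<theta> z) = a x\<close>.\<close>
  have "on_mor (Gamma \<theta>) (A, bar \<pi>) (A, bar {UNIV}) (?f, star \<pi> {UNIV} \<eta>) (\<theta> \<Zcomp> a) = (\<lambda>_. a x)"
  proof
    fix y
    show "on_mor (Gamma \<theta>) (A, bar \<pi>) (A, bar {UNIV}) (?f, star \<pi> {UNIV} \<eta>) (\<theta> \<Zcomp> a) y = a x"
      using Gamma_mor[OF p u e s, of z y A ?f] z ax ab(1) unfolding k by (auto simp: rcomp_def)
  qed
  then have "(\<lambda>_. \<theta> (a x))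
      = on_mor (Delta \<theta>) (A, bar \<pi>) (A, bar {UNIV}) (?f, star \<pi> {UNIV} \<eta>) (\<chi> (A, bar \<pi>) (\<theta> \<Zcomp> a))"
    using duality_natural[OF d A A p u f e s] duality_const[OF d A(2), of "a x"] ab(1)
    by (simp add: image_subset_iff)
  \<comment> \<open>On the \<open>Delta\<close> side the class is represented by \<open>x\<close>
    itself, so the value of \<open>\<chi>\<close> at \<open>x\<close> appears; lying in the image of
    \<open>A\<close>, it is unchanged by inverting and reapplying \<open>\<theta>\<close>.\<close>
  from fun_cong[OF this, of x] have "\<theta> (a x) = \<theta> (?f (inv_into A \<theta> (\<chi> (A, bar \<pi>) (\<theta> \<Zcomp> a) x)))"
    using Delta_mor[OF p u e t, of x x A ?f] c(2) unfolding k by simp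
  moreover have "\<chi> (A, bar \<pi>) (\<theta> \<Zcomp> a) x \<in> \<theta> ` A" using t unfolding Delta_obj by blast
  ultimately show "\<chi> (A, bar \<pi>) (\<theta> \<Zcomp> a) x = (a \<Zcomp> \<theta>) x"
    by (simp add: inv_into_into f_inv_into_f rcomp_def)
qed

theorem proposition4p2:
  fixes \<theta> :: "'x \<Rightarrow> 'x"
  shows "(\<exists>\<chi>. duality \<theta> \<chi>) \<and>
    (\<forall>\<chi>. duality \<theta> \<chi> \<longrightarrow>
      (\<forall>A \<in> Obj (P_cat \<theta>). \<forall>Q \<in> Obj (Pi_cat \<theta>).
        on_obj (Gamma \<theta>) (A, Q) = (\<lambda>a. \<theta> \<Zcomp> a) ` Reg_at \<theta> A Q \<and>
        (\<forall>a \<in> Reg_at \<theta> A Q. \<chi> (A, Q) (\<theta> \<Zcomp> a) = a \<Zcomp> \<theta>)))"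
proof (intro conjI allI impI ballI)
  show "\<exists>\<chi>. duality \<theta> \<chi>" using duality_transfer by blast
next
  fix \<chi> A Q assume d: "duality \<theta> \<chi>" and A: "A \<in> Obj (P_cat \<theta>)" and Q: "Q \<in> Obj (Pi_cat \<theta>)"
  have A': "A \<noteq> {}" "inj_on \<theta> A" using A by (simp_all add: P_cat_obj)
  obtain \<pi> where \<pi>: "Q = bar \<pi>" "sat_partition \<theta> \<pi>" using Q by (rule Pi_cat_objE)
  show "on_obj (Gamma \<theta>) (A, Q) = (\<lambda>a. \<theta> \<Zcomp> a) ` Reg_at \<theta> A Q"
    unfolding \<pi>(1) by (rule Gamma_obj_eq_image[OF \<pi>(2) A'(2)])
  show "\<chi> (A, Q) (\<theta> \<Zcomp> a) = a \<Zcomp> \<theta>" if "a \<in> Reg_at \<theta> A Q" for a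
    using duality_apply[OF d A' \<pi>(2)] that unfolding \<pi>(1) .
qed

end
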